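(* Let $k$ be algebraically closed of characteristic $p>0$, $G=\mathrm{GL}_n(k)$, $\nu$ a composition of $n$, $P=P_\nu$, and $\lambda$ the associated partition. Let $\varphi:G\times^P\mathfrak u_P\to\overline{\mathcal O_\lambda}$, $[g,X]\mapsto gXg^{-1}$. Let $F\in k[\mathfrak g]$ be $F(X)=\prod_{i=1}^{n-1}\det\big((I_n+X)_{\le i,\le i}\big)$ and let $f_\lambda\in k[\overline{\mathcal O_\lambda}]$ be $f_\lambda(X)=\prod_{i=1}^{n-1}s_{d_{\lambda,i}}(X_{\le i,\le i})$. Consider the function $\sigma=(\varphi^*F)^{p-1}$ on $G\times^P\mathfrak u_P$ (the KLT splitting). Then the top-degree nonzero homogeneous component of $\sigma$ has degree $(p-1)\dim(G/P)$, and this component equals $(\varphi^*f_\lambda)^{p-1}$. Moreover $\varphi^*f_\lambda$ vanishes on the exceptional locus $\varphi^{-1}(\overline{\mathcal O_\lambda}\setminus\mathcal O_\lambda)$ of $\varphi$.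
   Context: $T$ is the diagonal torus, $B$ the upper triangular Borel subgroup. For a composition $\nu=(\nu_1,\dots,\nu_s)$ of $n$, $P_\nu\supseteq B$ is the standard parabolic with diagonal block sizes $\nu_1,\dots,\nu_s$ in order, and $\mathfrak u_P$ is the Lie algebra of its unipotent radical. $\lambda$ is the partition transposed to the weakly decreasing rearrangement of $\nu$ ($\lambda_j=0$ beyond its length); $\mathcal O_\lambda$ is the nilpotent orbit with Jordan type $\lambda$, which is the Richardson orbit of $P$, and $\varphi$ is a resolution (proper birational) of the normal variety $\overline{\mathcal O_\lambda}$. $d_{\lambda,i}:=i-\sum_{j>n-i}\lambda_j$. $X_{\le i,\le i}$ is the submatrix of the first $i$ rows and columns; $s_j(Y)$ is the sum of principal $j\times j$ minors of $Y$. The grading on $k[G\times^P\mathfrak u_P]$ is induced by the standard grading of $k[\mathfrak u_P]=S(\mathfrak u_P^* )$ (equivalently by scalar multiplication on the fibres). The canonical bundle of $G\times^P\mathfrak u_P$ is trivial; with a suitable choice of volume form, $\sigma$ defines a Frobenius splitting of $G\times^P\mathfrak u_P$ (the Kumar–Lauritzen–Thomsen splitting), and its homogeneous component of degree $(p-1)\dim(G/P)$ is again a splitting. *)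

theory Defs
  imports "Jordan_Normal_Form.Jordan_Normal_Form" "Jordan_Normal_Form.DL_Submatrix"
    "HOL-Computational_Algebra.Polynomial"
begin

definition alg_closed_field :: "'a::field itself \<Rightarrow> bool" where
  "alg_closed_field _ \<longleftrightarrow> (\<forall>q :: 'a poly. degree q \<ge> 1 \<longrightarrow> (\<exists>x. poly q x = 0))"

definition composition :: "nat list \<Rightarrow> nat \<Rightarrow> bool" where
  "composition nu n \<longleftrightarrow> (\<forall>x\<in>set nu. 0 < x) \<and> sum_list nu = n"

(* block index (0-based) of row/column index r (0-based) for the block structure nu *)
definition block_of :: "nat list \<Rightarrow> nat \<Rightarrow> nat" where
  "block_of nu r = card {b. 1 \<le> b \<and> b \<le> length nu \<and> sum_list (take b nu) \<le> r}"

(* Lie algebra u_P of the unipotent radical of the standard parabolic P_nu *)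
definition u_P :: "nat list \<Rightarrow> 'a::field mat set" where
  "u_P nu = {X \<in> carrier_mat (sum_list nu) (sum_list nu).
     \<forall>r c. r < sum_list nu \<longrightarrow> c < sum_list nu \<longrightarrow> block_of nu c \<le> block_of nu r \<longrightarrow> X $$ (r,c) = 0}"

definition dim_G_mod_P :: "nat list \<Rightarrow> nat" where
  "dim_G_mod_P nu = (\<Sum>i<length nu. \<Sum>j<length nu. if i < j then nu ! i * nu ! j else 0)"

(* lambda_j (1-based j) of the partition transposed to the sorted nu; 0 beyond its length *)
definition lam :: "nat list \<Rightarrow> nat \<Rightarrow> nat" where
  "lam nu j = length (filter (\<lambda>x. j \<le> x) nu)"

definition lam_list :: "nat list \<Rightarrow> nat list" where
  "lam_list nu = filter (\<lambda>x. 0 < x) (map (lam nu) [1..<sum_list nu + 1])"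

definition nil_orbit :: "nat list \<Rightarrow> 'a::field mat set" where
  "nil_orbit ls = {Y. similar_mat Y (jordan_matrix (map (\<lambda>s. (s, 0)) ls))}"

definition d_lam :: "nat list \<Rightarrow> nat \<Rightarrow> nat" where
  "d_lam nu i = i - (\<Sum>j\<in>{sum_list nu - i + 1 .. sum_list nu}. lam nu j)"

definition lead_sub :: "'a mat \<Rightarrow> nat \<Rightarrow> 'a mat" where
  "lead_sub X i = mat i i (\<lambda>(r,c). X $$ (r,c))"

definition s_minor :: "nat \<Rightarrow> 'a::comm_ring_1 mat \<Rightarrow> 'a" where
  "s_minor j Y = (\<Sum>S\<in>{S. S \<subseteq> {0..<dim_row Y} \<and> card S = j}. det (submatrix Y S S))"

definition F_KLT :: "nat \<Rightarrow> 'a::comm_ring_1 mat \<Rightarrow> 'a" where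
  "F_KLT n X = (\<Prod>i\<in>{1..<n}. det (lead_sub (1\<^sub>m n + X) i))"

definition f_lam :: "nat list \<Rightarrow> 'a::comm_ring_1 mat \<Rightarrow> 'a" where
  "f_lam nu X = (\<Prod>i\<in>{1..<sum_list nu}. s_minor (d_lam nu i) (lead_sub X i))"

(* degree-d homogeneous component (w.r.t. scaling on the fibres) of a function
   h on G x u_P, evaluated at (g,X):  h(g, tX) = sum_d t^d h_d(g,X) *)
definition hom_comp :: "('a::field mat \<Rightarrow> 'a mat \<Rightarrow> 'a) \<Rightarrow> nat \<Rightarrow> 'a mat \<Rightarrow> 'a mat \<Rightarrow> 'a" where
  "hom_comp h d g X = coeff (THE q. \<forall>t. poly q t = h g (t \<cdot>\<^sub>m X)) d"

(* phi : G x^P u_P -> closure(O_lambda), [g,X] |-> g X g^{-1}  (g^{-1} = adj g / det g) *)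
definition phi :: "'a::field mat \<Rightarrow> 'a mat \<Rightarrow> 'a mat" where
  "phi g X = g * X * (inverse (det g) \<cdot>\<^sub>m adj_mat g)"

end

theory Submission
  imports Defs "Jordan_Normal_Form.Jordan_Normal_Form_Existence"
begin

text \<open>Everything is read off the minors of 1 + tX, as polynomials in t. For X in the nilradical let
  m = n - i. In a term of the Leibniz expansion of an i-minor, the indices moved by the permutation
  form m paths along which the block number strictly increases, so block b contributes at most
  min(m, nu_b) of them and the degree is at most d = sum_b min(m, nu_b) - m = d_{lambda,i}.
  By the expansion of minors of products the bound passes to conjugates Y of X; as the
  coefficient of t^j in det(1 + tY) restricted to the first i rows and columns is the sum of
  principal j-minors, multiplying over i gives the top component, the d_{lambda,i} adding up to
  dim G/P. The same argument for a Jordan matrix of type mu yields the bound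
  mu_1 + ... + mu_m - m, which is attained by some minor. Hence mu is dominated by lambda, and if
  no factor of f_lambda vanishes at Y then all partial sums agree and mu = lambda.
  Finally f_lambda is nonzero somewhere: a chain matrix in the nilradical has, for every i, an
  i-minor attaining the bound, and over an infinite field a generic conjugation turns it
  into the leading one, simultaneously for all i.\<close>

subsection \<open>Minors of 1 + tX\<close>

text \<open>Leading minors are not invariant under conjugation, while a degree bound on all minors
  of a given size is; hence arbitrary rows and columns throughout. The price is that non-vanishing
  at the leading position has to come from genericity, which is tested along affine lines:
  restricted to a line each condition is a univariate polynomial, with finitely many roots unless it
  is zero. An index of a block structure has a block number and a position in its block, and the two
  exchange roles. On the nilradical the level that rises is the block, and the chains attaining the
  bound join equal positions; in a Jordan matrix the level is the position, and the chains are the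
  blocks. Transposing nu into lambda is this exchange, through lambda_1 + ... + lambda_m = sum_b
  min(m, nu_b).\<close>

definition pmat :: "'a::comm_ring_1 mat \<Rightarrow> 'a poly mat" where
  "pmat X = mat (dim_row X) (dim_col X) (\<lambda>(r,c). [: if r = c then 1 else 0, X $$ (r,c) :])"

text \<open>Rows and columns are chosen by functions instead of subsets, so that the expansion for
  products is plain multilinearity. Reordering changes only the sign, and a repetition gives
  zero.\<close>

definition fminor :: "'a::comm_ring_1 mat \<Rightarrow> nat \<Rightarrow> (nat \<Rightarrow> nat) \<Rightarrow> (nat \<Rightarrow> nat) \<Rightarrow> 'a" where
  "fminor M i f h = det (mat i i (\<lambda>(r,c). M $$ (f r, h c)))"

lemma pmat_carrier [simp]: "X \<in> carrier_mat n m \<Longrightarrow> pmat X \<in> carrier_mat n m"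
  by (simp add: pmat_def)

lemma pmat_index [simp]:
  "X \<in> carrier_mat n m \<Longrightarrow> r < n \<Longrightarrow> c < m \<Longrightarrow>
    pmat X $$ (r,c) = [: if r = c then 1 else 0, X $$ (r,c) :]"
  by (auto simp: pmat_def)

lemma fminor_leibniz:
  "fminor M i f h = (\<Sum>p | p permutes {0..<i}. signof p * (\<Prod>r=0..<i. M $$ (f r, h (p r))))"
  unfolding fminor_def det_def
  by (auto intro!: sum.cong arg_cong2[of _ _ _ _ "(*)"] prod.cong dest: permutes_in_image)

text \<open>Conjugating a permutation by f keeps its sign, so the Leibniz sum may run over the
  permutations of S itself. Terms for different index sets then become comparable inside one
  symmetric group.\<close>

lemma det_reindex:
  assumes f: "bij_betw f {0..<k} S"
  shows "det (mat k k (\<lambda>(r,c). A $$ (f r, f c))) =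
    (\<Sum>p | p permutes S. signof p * (\<Prod>r\<in>S. A $$ (r, p r)))"
proof -
  let ?I = "{0..<k}" and ?g = "inv_into {0..<k} f"
  have inj: "inj_on f ?I" and S: "S = f ` ?I" using f by (auto simp: bij_betw_def)
  have g: "bij_betw ?g S ?I" using f by (rule bij_betw_inv_into)
  have "det (mat k k (\<lambda>(r,c). A $$ (f r, f c))) =
    (\<Sum>p | p permutes ?I. signof p * (\<Prod>r\<in>?I. A $$ (f r, f (p r))))"
    using fminor_leibniz[of A k f f] by (simp add: fminor_def)
  also have "\<dots> = (\<Sum>p | p permutes S. signof p * (\<Prod>r\<in>S. A $$ (r, p r)))"
  proof (rule sum.reindex_bij_witness[where i = "map_permutation S ?g" and j = "map_permutation ?I f"])
    fix p assume "p \<in> {p. p permutes ?I}"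
    then have p: "p permutes ?I" by simp
    show "map_permutation S ?g (map_permutation ?I f p) = p"
      by (rule map_permutation_compose_inv[OF f p]) (use inj in auto)
    show "map_permutation ?I f p \<in> {p. p permutes S}"
      using map_permutation_permutes[OF f p] by simp
    have "(\<Prod>r\<in>S. A $$ (r, map_permutation ?I f p r)) = (\<Prod>r\<in>?I. A $$ (f r, f (p r)))"
      unfolding S using inj by (subst prod.reindex) (auto simp: map_permutation_apply)
    then show "signof (map_permutation ?I f p) * (\<Prod>r\<in>S. A $$ (r, map_permutation ?I f p r)) =
      signof p * (\<Prod>r\<in>?I. A $$ (f r, f (p r)))"
      using sign_map_permutation[OF inj p] by simp
  next
    fix p assume "p \<in> {p. p permutes S}"
    then have p: "p permutes S" by simp
    show "map_permutation ?I f (map_permutation S ?g p) = p"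
      by (rule map_permutation_compose_inv[OF g p]) (use S in \<open>auto intro: f_inv_into_f\<close>)
    show "map_permutation S ?g p \<in> {p. p permutes ?I}"
      using map_permutation_permutes[OF g p] by simp
  qed
  finally show ?thesis .
qed

lemma det_principal_submatrix:
  assumes A: "A \<in> carrier_mat n n" and S: "S \<subseteq> {0..<n}"
  shows "det (submatrix A S S) = (\<Sum>p | p permutes S. signof p * (\<Prod>r\<in>S. A $$ (r, p r)))"
proof -
  have fin: "finite S" using S finite_subset by blast
  have *: "{i. i < n \<and> i \<in> S} = S" using S by auto
  have inj: "inj_on (pick S) {0..<card S}"
  proof (rule inj_onI)
    fix x y assume "x \<in> {0..<card S}" "y \<in> {0..<card S}" "pick S x = pick S y"
    then show "x = y" using pick_mono_le[of x S y] pick_mono_le[of y S x]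
      by (metis atLeastLessThan_iff less_irrefl linorder_neqE_nat)
  qed
  have "pick S ` {0..<card S} = S"
    by (rule card_subset_eq[OF fin])
      (use pick_in_set_le card_image[OF inj] in auto)
  then have "bij_betw (pick S) {0..<card S} S" using inj by (simp add: bij_betw_def)
  from det_reindex[OF this, of A] show ?thesis
    using A * by (simp add: submatrix_def)
qed

lemma coeff_signof_mult: "coeff (signof p * q) j = signof p * coeff q j"
  by (simp add: sign_def)

lemma prod_monom: "(\<Prod>x\<in>S. monom (f x) (k x)) = monom (\<Prod>x\<in>S. f x) (\<Sum>x\<in>S. k x)"
  by (induction S rule: infinite_finite_induct) (auto simp: mult_monom)

text \<open>In a Leibniz term of det(1 + tA) every row chooses either its entry times t or the
  Kronecker delta. If S is the set of rows choosing t, the deltas force p to fix everything outside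
  S, and what remains is a term of the principal minor on S times t^(card S).\<close>

lemma coeff_det_pmat:
  assumes A: "A \<in> carrier_mat n n"
  shows "coeff (det (pmat A)) j = s_minor j A"
proof -
  let ?I = "{0..<n}"
  have fin: "finite {p. p permutes ?I}" by (simp add: finite_permutations)
  have row: "(\<Prod>r\<in>?I. pmat A $$ (r, p r)) =
      (\<Sum>S\<in>Pow ?I. monom (if p permutes S then \<Prod>r\<in>S. A $$ (r, p r) else 0) (card S))"
    if p: "p permutes ?I" for p
  proof -
    have "(\<Prod>r\<in>?I. pmat A $$ (r, p r)) =
        (\<Prod>r\<in>?I. monom (A $$ (r, p r)) 1 + monom (if r = p r then 1 else 0) 0)"
      using A permutes_in_image[OF p]
      by (intro prod.cong refl) (simp add: monom_altdef)
    also have "\<dots> = (\<Sum>S\<in>Pow ?I. (\<Prod>r\<in>S. monom (A $$ (r, p r)) 1) *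
        (\<Prod>r\<in>?I - S. monom (if r = p r then 1 else 0) 0))"
      by (rule prod_add) simp
    also have "\<dots> = (\<Sum>S\<in>Pow ?I. monom (if p permutes S then \<Prod>r\<in>S. A $$ (r, p r) else 0) (card S))"
    proof (rule sum.cong[OF refl])
      fix S assume S: "S \<in> Pow ?I"
      have eq: "p permutes S \<longleftrightarrow> (\<forall>r\<in>?I - S. r = p r)"
      proof
        assume "p permutes S" then show "\<forall>r\<in>?I - S. r = p r"
          by (simp add: permutes_def)
      next
        assume "\<forall>r\<in>?I - S. r = p r"
        then show "p permutes S"
          using permutes_superset[OF p, of S] by metis
      qed
      have "(\<Prod>r\<in>?I - S. (if r = p r then 1 else 0 :: 'a)) = (if p permutes S then 1 else 0)"
        unfolding eq by (auto intro!: prod.neutral prod_zero)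
      then show "(\<Prod>r\<in>S. monom (A $$ (r, p r)) 1) * (\<Prod>r\<in>?I - S. monom (if r = p r then 1 else 0) 0)
          = monom (if p permutes S then \<Prod>r\<in>S. A $$ (r, p r) else 0) (card S)"
        by (simp add: prod_monom mult_monom)
    qed
    finally show ?thesis .
  qed
  have "coeff (det (pmat A)) j = (\<Sum>p | p permutes ?I. \<Sum>S\<in>Pow ?I.
      (if card S = j then signof p * (if p permutes S then \<Prod>r\<in>S. A $$ (r, p r) else 0) else 0))"
    unfolding det_def'[OF pmat_carrier[OF A]] coeff_sum coeff_signof_mult
    by (auto simp: row coeff_sum sum_distrib_left intro!: sum.cong)
  \<comment> \<open>With S fixed first, the permutations that survive are exactly those of
    S.\<close>
  also have "\<dots> = (\<Sum>S\<in>Pow ?I. if card S = j then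
      (\<Sum>p | p permutes ?I. if p permutes S then signof p * (\<Prod>r\<in>S. A $$ (r, p r)) else 0) else 0)"
    by (subst sum.swap) (auto intro!: sum.cong)
  also have "\<dots> = (\<Sum>S | S \<subseteq> ?I \<and> card S = j.
      (\<Sum>p | p permutes ?I. if p permutes S then signof p * (\<Prod>r\<in>S. A $$ (r, p r)) else 0))"
    by (subst sum.inter_filter[symmetric]) (auto intro!: sum.cong)
  also have "\<dots> = (\<Sum>S | S \<subseteq> ?I \<and> card S = j. det (submatrix A S S))"
  proof (rule sum.cong[OF refl])
    fix S assume "S \<in> {S. S \<subseteq> ?I \<and> card S = j}"
    then have S: "S \<subseteq> ?I" by simp
    have "{p \<in> {p. p permutes ?I}. p permutes S} = {p. p permutes S}"
      using permutes_subset[OF _ S] by auto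
    then show "(\<Sum>p | p permutes ?I. if p permutes S then signof p * (\<Prod>r\<in>S. A $$ (r, p r)) else 0)
        = det (submatrix A S S)"
      using sum.inter_filter[OF fin, of "\<lambda>p. signof p * (\<Prod>r\<in>S. A $$ (r, p r))" "\<lambda>p. p permutes S"]
      by (simp add: det_principal_submatrix[OF A S])
  qed
  finally show ?thesis using A by (simp add: s_minor_def)
qed

text \<open>Multilinearity in the rows: row r of the product combines the rows
  \<open>\<kappa> r\<close> of M, one choice for each r. Non-injective choices are summed too; their
  minors vanish.\<close>

lemma fminor_mult_left:
  assumes P: "P \<in> carrier_mat n n" and M: "M \<in> carrier_mat n n"
    and f: "\<And>r. r < i \<Longrightarrow> f r < n" and h: "\<And>r. r < i \<Longrightarrow> h r < n"
  shows "fminor (P * M) i f h =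
    (\<Sum>\<kappa>\<in>{0..<i} \<rightarrow>\<^sub>E {0..<n}. (\<Prod>r=0..<i. P $$ (f r, \<kappa> r)) * fminor M i \<kappa> h)"
proof -
  let ?I = "{0..<i}" and ?E = "{0..<i} \<rightarrow>\<^sub>E {0..<n}"
  have row: "(\<Prod>r=0..<i. (P * M) $$ (f r, h (p r))) =
      (\<Sum>\<kappa>\<in>?E. \<Prod>r=0..<i. P $$ (f r, \<kappa> r) * M $$ (\<kappa> r, h (p r)))" if p: "p permutes ?I" for p
  proof -
    have "(\<Prod>r=0..<i. (P * M) $$ (f r, h (p r))) =
        (\<Prod>r=0..<i. \<Sum>k\<in>{0..<n}. P $$ (f r, k) * M $$ (k, h (p r)))"
      using P M f h permutes_in_image[OF p]
      by (intro prod.cong refl) (auto simp: scalar_prod_def)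
    then show ?thesis by (simp add: prod_sum_PiE)
  qed
  have "fminor (P * M) i f h = (\<Sum>p | p permutes ?I. \<Sum>\<kappa>\<in>?E.
      (\<Prod>r=0..<i. P $$ (f r, \<kappa> r)) * (signof p * (\<Prod>r=0..<i. M $$ (\<kappa> r, h (p r)))))"
    by (auto simp: fminor_leibniz row prod.distrib sum_distrib_left ac_simps intro!: sum.cong)
  also have "\<dots> = (\<Sum>\<kappa>\<in>?E. (\<Prod>r=0..<i. P $$ (f r, \<kappa> r)) * fminor M i \<kappa> h)"
    by (subst sum.swap) (simp add: fminor_leibniz sum_distrib_left)
  finally show ?thesis .
qed

lemma fminor_transpose:
  assumes M: "M \<in> carrier_mat n n"
    and f: "\<And>r. r < i \<Longrightarrow> f r < n" and h: "\<And>r. r < i \<Longrightarrow> h r < n"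
  shows "fminor (transpose_mat M) i f h = fminor M i h f"
proof -
  have "mat i i (\<lambda>(r,c). transpose_mat M $$ (f r, h c)) =
    transpose_mat (mat i i (\<lambda>(r,c). M $$ (h r, f c)))"
    by (rule eq_matI) (use assms in auto)
  then show ?thesis unfolding fminor_def
    by (simp add: det_transpose[of _ i])
qed

lemma fminor_mult_right:
  assumes P: "P \<in> carrier_mat n n" and M: "M \<in> carrier_mat n n"
    and f: "\<And>r. r < i \<Longrightarrow> f r < n" and h: "\<And>r. r < i \<Longrightarrow> h r < n"
  shows "fminor (M * P) i f h =
    (\<Sum>\<kappa>\<in>{0..<i} \<rightarrow>\<^sub>E {0..<n}. (\<Prod>r=0..<i. P $$ (\<kappa> r, h r)) * fminor M i f \<kappa>)"
proof -
  have "fminor (M * P) i f h = fminor (transpose_mat (M * P)) i h f"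
    by (rule fminor_transpose[symmetric]) (use assms in auto)
  also have "transpose_mat (M * P) = transpose_mat P * transpose_mat M"
    using transpose_mult[OF M P] .
  also have "fminor \<dots> i h f = (\<Sum>\<kappa>\<in>{0..<i} \<rightarrow>\<^sub>E {0..<n}.
      (\<Prod>r=0..<i. transpose_mat P $$ (h r, \<kappa> r)) * fminor (transpose_mat M) i \<kappa> f)"
    by (rule fminor_mult_left) (use assms in auto)
  also have "\<dots> = (\<Sum>\<kappa>\<in>{0..<i} \<rightarrow>\<^sub>E {0..<n}. (\<Prod>r=0..<i. P $$ (\<kappa> r, h r)) * fminor M i f \<kappa>)"
  proof (rule sum.cong[OF refl])
    fix \<kappa> assume "\<kappa> \<in> {0..<i} \<rightarrow>\<^sub>E {0..<n}"
    then have k: "\<And>r. r < i \<Longrightarrow> \<kappa> r < n" by (auto simp: PiE_iff)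
    have "(\<Prod>r=0..<i. transpose_mat P $$ (h r, \<kappa> r)) = (\<Prod>r=0..<i. P $$ (\<kappa> r, h r))"
      using P h k by (intro prod.cong) auto
    then show "(\<Prod>r=0..<i. transpose_mat P $$ (h r, \<kappa> r)) * fminor (transpose_mat M) i \<kappa> f =
       (\<Prod>r=0..<i. P $$ (\<kappa> r, h r)) * fminor M i f \<kappa>"
      using fminor_transpose[OF M k f] by simp
  qed
  finally show ?thesis .
qed

subsection \<open>Degree bounds for minors\<close>

text \<open>The path argument as a count. Each moved r is an edge from \<open>f r\<close> to
  \<open>y r\<close>; injectivity makes the edges disjoint paths, which cannot close up because the
  level rises. With the indices missed by both maps counted as paths without edges there are n - i
  paths, so the left side is their number of vertices.\<close>

lemma card_moved_le_levels:
  fixes f y lev :: "nat \<Rightarrow> nat"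
  assumes f: "inj_on f {0..<i}" "f ` {0..<i} \<subseteq> {0..<n}"
    and y: "inj_on y {0..<i}" "y ` {0..<i} \<subseteq> {0..<n}"
    and step: "\<And>r. r < i \<Longrightarrow> f r \<noteq> y r \<Longrightarrow> lev (f r) < lev (y r)"
    and B: "\<And>x. x < n \<Longrightarrow> lev x < B"
  shows "card {r. r < i \<and> f r \<noteq> y r} + (n - i) \<le> (\<Sum>b<B. min (n - i) (card {x. x < n \<and> lev x = b}))"
proof -
  let ?V = "{r. r < i \<and> f r \<noteq> y r}" and ?L = "{r. r < i \<and> f r = y r}"
  \<comment> \<open>The vertices of the paths: all indices except the fixed ones.\<close>
  define W where "W = {0..<n} - f ` ?L"
  have i: "i \<le> n" using card_inj_on_le[OF f] by simp
  have finW: "finite W" by (simp add: W_def)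
  have cVL: "card ?V + card ?L = i"
  proof -
    have "card ?V + card ?L = card (?V \<union> ?L)" by (rule card_Un_disjoint[symmetric]) auto
    also have "?V \<union> ?L = {0..<i}" by auto
    finally show ?thesis by simp
  qed
  have cL: "card (f ` ?L) = card ?L"
    by (rule card_image) (use f(1) in \<open>auto simp: inj_on_def\<close>)
  have cV: "card (f ` ?V) = card ?V"
    by (rule card_image) (use f(1) in \<open>auto simp: inj_on_def\<close>)
  have "card W = n - card (f ` ?L)"
    unfolding W_def using card_Diff_subset[of "f ` ?L" "{0..<n}"] f(2) by force
  then have cW: "card W = card ?V + (n - i)" using cL cVL i by simp
  have fVW: "f ` ?V \<subseteq> W"
  proof (rule image_subsetI)
    fix r assume r: "r \<in> ?V"
    have "f r \<noteq> f r'" if "r' \<in> ?L" for r'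
      using that r inj_onD[OF f(1), of r r'] by auto
    moreover have "f r < n" using r f(2) by (auto simp: image_subset_iff)
    ultimately show "f r \<in> W" unfolding W_def by auto
  qed
  have yVW: "y r \<in> W" if r: "r < i" "f r \<noteq> y r" for r
  proof -
    have "y r \<noteq> f r'" if "r' < i" "f r' = y r'" for r'
      using that r y(1) by (metis atLeastLessThan_iff inj_onD le0)
    moreover have "y r < n" using r y(2) by (auto simp: image_subset_iff)
    ultimately show ?thesis unfolding W_def by auto
  qed
  \<comment> \<open>Sending \<open>f r\<close> to \<open>y r\<close> injects the non-final vertices
    of level at least b into the vertices of level above b, and there are n - i final vertices. So
    at most n - i vertices lie on level b itself.\<close>
  have level: "card {x \<in> W. lev x = b} \<le> n - i" for b
  proof -
    let ?ge = "{x \<in> W. lev x \<ge> b}" and ?gt = "{x \<in> W. lev x > b}"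
    let ?V' = "{r \<in> ?V. lev (f r) \<ge> b}"
    have "card (?ge \<inter> f ` ?V) = card (f ` ?V')"
      using fVW by (intro arg_cong[of _ _ card]) auto
    also have "\<dots> = card ?V'"
      by (rule card_image) (use f(1) in \<open>auto simp: inj_on_def\<close>)
    also have "\<dots> = card (y ` ?V')"
      by (rule card_image[symmetric]) (use y(1) in \<open>auto simp: inj_on_def\<close>)
    also have "\<dots> \<le> card ?gt"
      using yVW step finW by (intro card_mono) (auto intro: le_less_trans)
    finally have 1: "card (?ge \<inter> f ` ?V) \<le> card ?gt" .
    have "card (?ge - f ` ?V) \<le> card (W - f ` ?V)"
      by (rule card_mono) (use finW in auto)
    also have "\<dots> = n - i"
      using card_Diff_subset[OF _ fVW] cV cW by simp
    finally have 2: "card (?ge - f ` ?V) \<le> n - i" .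
    have "card ?ge = card (?ge \<inter> f ` ?V) + card (?ge - f ` ?V)"
      using card_Int_Diff[of ?ge "f ` ?V"] finW by simp
    moreover have "card ?ge = card {x \<in> W. lev x = b} + card ?gt"
      by (subst card_Un_disjoint[symmetric]) (use finW in \<open>auto intro!: arg_cong[of _ _ card]\<close>)
    ultimately show ?thesis using 1 2 by linarith
  qed
  have "card W = card (\<Union>b\<in>{..<B}. {x \<in> W. lev x = b})"
    using B by (intro arg_cong[of _ _ card]) (auto simp: W_def)
  also have "\<dots> = (\<Sum>b<B. card {x \<in> W. lev x = b})"
    using finW by (intro card_UN_disjoint) auto
  also have "\<dots> \<le> (\<Sum>b<B. min (n - i) (card {x. x < n \<and> lev x = b}))"
    using level by (intro sum_mono) (auto intro!: card_mono simp: W_def)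
  finally show ?thesis using cW by simp
qed

lemma fminor_not_inj:
  assumes "\<not> inj_on f {0..<i} \<or> \<not> inj_on h {0..<i}"
  shows "fminor M i f h = 0"
  using assms
proof
  assume "\<not> inj_on f {0..<i}"
  then obtain a b where "a < i" "b < i" "a \<noteq> b" "f a = f b" by (auto simp: inj_on_def)
  then show ?thesis unfolding fminor_def
    by (intro det_identical_rows[of _ i a b] eq_vecI) auto
next
  assume "\<not> inj_on h {0..<i}"
  then obtain a b where "a < i" "b < i" "a \<noteq> b" "h a = h b" by (auto simp: inj_on_def)
  then show ?thesis unfolding fminor_def
    by (intro det_identical_columns[of _ i a b] eq_vecI) auto
qed

text \<open>In a nonzero Leibniz term only the moved indices contribute to the degree, at most 1
  each, and each raises the level. The level function is left abstract so as to serve both the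
  nilradical and Jordan matrices.\<close>

lemma degree_fminor_le_levels:
  fixes X :: "'a::idom mat" and lev :: "nat \<Rightarrow> nat"
  assumes X: "X \<in> carrier_mat n n"
    and f: "\<And>r. r < i \<Longrightarrow> f r < n" and h: "\<And>r. r < i \<Longrightarrow> h r < n"
    and lev: "\<And>r c. r < n \<Longrightarrow> c < n \<Longrightarrow> X $$ (r,c) \<noteq> 0 \<Longrightarrow> lev r < lev c"
    and B: "\<And>x. x < n \<Longrightarrow> lev x < B"
  shows "degree (fminor (pmat X) i f h) \<le>
    (\<Sum>b<B. min (n - i) (card {x. x < n \<and> lev x = b})) - (n - i)" (is "_ \<le> ?S - _")
proof (cases "inj_on f {0..<i} \<and> inj_on h {0..<i}")
  case False
  then show ?thesis by (simp add: fminor_not_inj)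
next
  case True
  show ?thesis unfolding fminor_leibniz
  proof (rule degree_sum_le)
    fix p assume "p \<in> {p. p permutes {0..<i}}"
    then have p: "p permutes {0..<i}" by simp
    have pi: "p r < i" if "r < i" for r using permutes_in_image[OF p, of r] that by simp
    let ?t = "\<Prod>r=0..<i. pmat X $$ (f r, h (p r))"
    have "degree ?t \<le> ?S - (n - i)"
    proof (cases "?t = 0")
      case False
      have ent: "pmat X $$ (f r, h (p r)) = [: if f r = h (p r) then 1 else 0, X $$ (f r, h (p r)) :]"
        if "r < i" for r using pmat_index[OF X f[OF that] h[OF pi[OF that]]] .
      \<comment> \<open>A nonzero diagonal entry would raise the level from x to x; so the factors
        with \<open>f r = h (p r)\<close> are the constant 1.\<close>
      have diag: "X $$ (x, x) = 0" if "x < n" for x using lev[OF that that] by blast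
      have "degree ?t \<le> (\<Sum>r=0..<i. degree (pmat X $$ (f r, h (p r))))"
        using degree_prod_sum_le[of "{0..<i}"] by (simp add: o_def)
      also have "\<dots> \<le> (\<Sum>r=0..<i. if f r \<noteq> h (p r) then 1 else 0)"
        using ent diag h pi by (intro sum_mono) auto
      also have "\<dots> = card {r. r < i \<and> f r \<noteq> (h \<circ> p) r}"
        by (subst sum.inter_filter[symmetric]) (auto intro!: arg_cong[of _ _ card])
      finally have "degree ?t \<le> card {r. r < i \<and> f r \<noteq> (h \<circ> p) r}" .
      moreover have "card {r. r < i \<and> f r \<noteq> (h \<circ> p) r} + (n - i) \<le> ?S"
      proof (rule card_moved_le_levels)
        show "inj_on (h \<circ> p) {0..<i}"
          using True p by (intro comp_inj_on) (auto simp: permutes_image permutes_inj_on)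
        fix r assume r: "r < i" "f r \<noteq> (h \<circ> p) r"
        have "pmat X $$ (f r, h (p r)) \<noteq> 0" using False r by auto
        then have "X $$ (f r, h (p r)) \<noteq> 0" using ent r by auto
        then show "lev (f r) < lev ((h \<circ> p) r)" using lev f h pi r by simp
      qed (use True f h pi B in auto)
      ultimately show ?thesis by linarith
    next
      case True
      then show ?thesis by (simp only: degree_0 le0)
    qed
    then show "degree (signof p * ?t) \<le> ?S - (n - i)" by (simp add: degree_signof_mult)
  qed (simp add: finite_permutations)
qed

section \<open>Conjugation by constant matrices over the polynomial ring\<close>

abbreviation cmat :: "'a::comm_ring_1 mat \<Rightarrow> 'a poly mat" where
  "cmat P \<equiv> map_mat (\<lambda>x. [:x:]) P"

lemma const_prod: "(\<Prod>x\<in>S. [:f x:]) = [:\<Prod>x\<in>S. f x:]"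
  by (induction S rule: infinite_finite_induct) (auto simp: one_pCons mult.commute)

text \<open>A constant matrix acts on each coefficient separately, so the expansion holds degree by
  degree.\<close>

lemma coeff_fminor_cmat_left:
  assumes P: "P \<in> carrier_mat n n" and M: "M \<in> carrier_mat n n"
    and f: "\<And>r. r < i \<Longrightarrow> f r < n" and h: "\<And>r. r < i \<Longrightarrow> h r < n"
  shows "coeff (fminor (cmat P * M) i f h) e =
    (\<Sum>\<kappa>\<in>{0..<i} \<rightarrow>\<^sub>E {0..<n}. (\<Prod>r=0..<i. P $$ (f r, \<kappa> r)) * coeff (fminor M i \<kappa> h) e)"
proof -
  have "(\<Prod>r=0..<i. cmat P $$ (f r, \<kappa> r)) = [:\<Prod>r=0..<i. P $$ (f r, \<kappa> r):]"
    if "\<kappa> \<in> {0..<i} \<rightarrow>\<^sub>E {0..<n}" for \<kappa>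
    unfolding const_prod[symmetric] using P f that by (intro prod.cong) (auto simp: PiE_iff)
  then show ?thesis
    by (subst fminor_mult_left[of _ n]) (use assms in \<open>auto simp: coeff_sum intro!: sum.cong\<close>)
qed

lemma coeff_fminor_cmat_right:
  assumes P: "P \<in> carrier_mat n n" and M: "M \<in> carrier_mat n n"
    and f: "\<And>r. r < i \<Longrightarrow> f r < n" and h: "\<And>r. r < i \<Longrightarrow> h r < n"
  shows "coeff (fminor (M * cmat P) i f h) e =
    (\<Sum>\<kappa>\<in>{0..<i} \<rightarrow>\<^sub>E {0..<n}. (\<Prod>r=0..<i. P $$ (\<kappa> r, h r)) * coeff (fminor M i f \<kappa>) e)"
proof -
  have "(\<Prod>r=0..<i. cmat P $$ (\<kappa> r, h r)) = [:\<Prod>r=0..<i. P $$ (\<kappa> r, h r):]"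
    if "\<kappa> \<in> {0..<i} \<rightarrow>\<^sub>E {0..<n}" for \<kappa>
    unfolding const_prod[symmetric] using P h that by (intro prod.cong) (auto simp: PiE_iff)
  then show ?thesis
    by (subst fminor_mult_right[of _ n]) (use assms in \<open>auto simp: coeff_sum intro!: sum.cong\<close>)
qed

lemma cmat_mult:
  assumes "A \<in> carrier_mat n m" "B \<in> carrier_mat m k"
  shows "cmat (A * B) = cmat A * cmat B"
proof -
  interpret comm_ring_hom "\<lambda>x::'a. [:x:]" by unfold_locales (auto simp: one_pCons)
  show ?thesis using mat_hom_mult[OF assms] .
qed

lemma cmat_one: "cmat (1\<^sub>m n) = 1\<^sub>m n"
  by (rule eq_matI) (auto simp: one_pCons)

lemma pmat_eq:
  assumes X: "X \<in> carrier_mat n n"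
  shows "pmat X = 1\<^sub>m n + [:0,1:] \<cdot>\<^sub>m cmat X"
  by (rule eq_matI) (use X in \<open>auto simp: pmat_def one_pCons\<close>)

lemma pmat_conj:
  assumes P: "P \<in> carrier_mat n n" and Q: "Q \<in> carrier_mat n n" and PQ: "P * Q = 1\<^sub>m n"
    and X: "X \<in> carrier_mat n n"
  shows "pmat (P * X * Q) = cmat P * pmat X * cmat Q"
proof -
  have c: "cmat P \<in> carrier_mat n n" "cmat Q \<in> carrier_mat n n" "cmat X \<in> carrier_mat n n"
    using P Q X by auto
  have "cmat P * pmat X = cmat P * 1\<^sub>m n + cmat P * ([:0,1:] \<cdot>\<^sub>m cmat X)"
    unfolding pmat_eq[OF X] by (rule mult_add_distrib_mat) (use c in auto)
  also have "\<dots> = cmat P + [:0,1:] \<cdot>\<^sub>m (cmat P * cmat X)"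
    using c by (simp only: mult_smult_distrib[OF c(1,3)] right_mult_one_mat)
  finally have "cmat P * pmat X * cmat Q = (cmat P + [:0,1:] \<cdot>\<^sub>m (cmat P * cmat X)) * cmat Q"
    by simp
  also have "\<dots> = cmat P * cmat Q + [:0,1:] \<cdot>\<^sub>m (cmat P * cmat X * cmat Q)"
    using c by (simp add: add_mult_distrib_mat[of _ n n] mult_smult_assoc_mat[of _ n n])
  also have "\<dots> = pmat (P * X * Q)"
    using P Q X by (simp add: pmat_eq[of _ n] cmat_mult[symmetric, of _ n n _ n] PQ cmat_one)
  finally show ?thesis by simp
qed

text \<open>The hypothesis is about all i-minors at once: a minor of the conjugate combines minors
  of B with arbitrary rows and columns, so only such a uniform condition passes to similar
  matrices.\<close>

lemma coeff_fminor_similar: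
  assumes sim: "similar_mat A B" and B: "B \<in> carrier_mat n n"
    and zero: "\<And>f h. (\<And>r. r < i \<Longrightarrow> f r < n) \<Longrightarrow> (\<And>r. r < i \<Longrightarrow> h r < n) \<Longrightarrow>
      coeff (fminor (pmat B) i f h) e = 0"
    and f: "\<And>r. r < i \<Longrightarrow> f r < n" and h: "\<And>r. r < i \<Longrightarrow> h r < n"
  shows "coeff (fminor (pmat A) i f h) e = 0"
proof -
  from similar_matD[OF sim] B obtain P Q where PQ: "P \<in> carrier_mat n n" "Q \<in> carrier_mat n n"
    "P * Q = 1\<^sub>m n" "A = P * B * Q" by auto
  have M: "pmat B \<in> carrier_mat n n" "cmat P * pmat B \<in> carrier_mat n n"
    using B PQ by auto
  have left: "coeff (fminor (cmat P * pmat B) i f \<kappa>) e = 0" if "\<And>r. r < i \<Longrightarrow> \<kappa> r < n" for \<kappa>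
    using that f zero PQ M by (subst coeff_fminor_cmat_left[of _ n]) (auto intro!: sum.neutral simp: PiE_iff)
  show ?thesis unfolding PQ pmat_conj[OF PQ(1-3) B]
    using PQ M f h left by (subst coeff_fminor_cmat_right[of _ n]) (auto intro!: sum.neutral simp: PiE_iff)
qed

lemma degree_fminor_similar:
  assumes sim: "similar_mat A B" and B: "B \<in> carrier_mat n n"
    and deg: "\<And>f h. (\<And>r. r < i \<Longrightarrow> f r < n) \<Longrightarrow> (\<And>r. r < i \<Longrightarrow> h r < n) \<Longrightarrow>
      degree (fminor (pmat B) i f h) \<le> d"
    and f: "\<And>r. r < i \<Longrightarrow> f r < n" and h: "\<And>r. r < i \<Longrightarrow> h r < n"
  shows "degree (fminor (pmat A) i f h) \<le> d"
proof (rule degree_le, intro allI impI)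
  fix e assume e: "d < e"
  show "coeff (fminor (pmat A) i f h) e = 0"
  proof (rule coeff_fminor_similar[OF sim B _ f h])
    fix f' h' :: "nat \<Rightarrow> nat"
    assume "\<And>r. r < i \<Longrightarrow> f' r < n" "\<And>r. r < i \<Longrightarrow> h' r < n"
    then have "degree (fminor (pmat B) i f' h') \<le> d" by (rule deg)
    with e show "coeff (fminor (pmat B) i f' h') e = 0" by (intro coeff_eq_0) linarith
  qed
qed

subsection \<open>Chain matrices\<close>

text \<open>A nontrivial permutation with nonzero product would strictly raise the total weight,
  which permuting leaves unchanged. This is triangularity for an order of the indices given by
  \<kappa>.\<close>

lemma det_acyclic:
  fixes A :: "'a::idom mat" and \<kappa> :: "nat \<Rightarrow> int"
  assumes A: "A \<in> carrier_mat k k"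
    and key: "\<And>r c. r < k \<Longrightarrow> c < k \<Longrightarrow> r \<noteq> c \<Longrightarrow> A $$ (r,c) \<noteq> 0 \<Longrightarrow> \<kappa> r < \<kappa> c"
  shows "det A = (\<Prod>r=0..<k. A $$ (r,r))"
proof -
  let ?I = "{0..<k}"
  have "(\<Prod>r=0..<k. A $$ (r, p r)) = 0" if p: "p permutes ?I" and ne: "p \<noteq> id" for p
  proof (rule ccontr)
    assume nz: "(\<Prod>r=0..<k. A $$ (r, p r)) \<noteq> 0"
    have lt: "\<kappa> r < \<kappa> (p r)" if "r < k" "p r \<noteq> r" for r
      using nz that permutes_in_image[OF p, of r] by (intro key) auto
    obtain x where x: "p x \<noteq> x" using ne by (auto simp: fun_eq_iff)
    then have xk: "x < k" using permutes_not_in[OF p, of x] by auto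
    have "(\<Sum>r\<in>?I. \<kappa> r) < (\<Sum>r\<in>?I. \<kappa> (p r))"
    proof (rule sum_strict_mono_ex1)
      show "\<forall>r\<in>?I. \<kappa> r \<le> \<kappa> (p r)"
        using lt by (metis atLeastLessThan_iff less_imp_le order_refl)
      show "\<exists>r\<in>?I. \<kappa> r < \<kappa> (p r)" using lt[OF xk x] xk by auto
    qed simp
    also have "\<dots> = (\<Sum>r\<in>?I. \<kappa> r)"
      using sum.permute[OF p, of \<kappa>] by (simp add: o_def)
    finally show False by simp
  qed
  then have "det A = (\<Sum>p\<in>{id}. signof p * (\<Prod>r=0..<k. A $$ (r, p r)))"
    unfolding det_def'[OF A]
    by (intro sum.mono_neutral_right) (auto simp: finite_permutations permutes_id)
  then show ?thesis by simp
qed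

text \<open>Each index is linked to the next larger one with the same label; a nilpotent Jordan matrix
  has this form, with the block number as label.\<close>

definition linked :: "nat \<Rightarrow> (nat \<Rightarrow> nat) \<Rightarrow> nat \<Rightarrow> nat \<Rightarrow> bool" where
  "linked n lab x y \<longleftrightarrow> x < y \<and> y < n \<and> lab x = lab y \<and> (\<forall>q. x < q \<and> q < y \<longrightarrow> lab q \<noteq> lab x)"

definition chain_mat :: "nat \<Rightarrow> (nat \<Rightarrow> nat) \<Rightarrow> 'a::comm_ring_1 mat" where
  "chain_mat n lab = mat n n (\<lambda>(r,c). if linked n lab r c then 1 else 0)"

lemma chain_mat_carrier [simp]: "chain_mat n lab \<in> carrier_mat n n"
  by (simp add: chain_mat_def)

lemma linked_unique: "linked n lab x z \<Longrightarrow> linked n lab y z \<Longrightarrow> x = y"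
  unfolding linked_def by (metis linorder_neqE_nat)

lemma linked_exists:
  assumes "x < y" "y < n" "lab x = lab y"
  shows "\<exists>z. linked n lab x z"
proof -
  define z where "z = (LEAST z. x < z \<and> lab z = lab x)"
  have P: "x < z \<and> lab z = lab x" unfolding z_def
    by (rule LeastI[of _ y]) (use assms in auto)
  have "z \<le> y" unfolding z_def by (rule Least_le) (use assms in auto)
  moreover have "lab q \<noteq> lab x" if "x < q" "q < z" for q
    using not_less_Least[OF that(2)[unfolded z_def]] that(1) by blast
  ultimately have "linked n lab x z"
    unfolding linked_def using assms(2) P by auto
  then show ?thesis ..
qed

text \<open>Rows with a small label are paired with their successors in the chain, the other rows
  with themselves. The diagonal then consists of t and 1, and the matrix is triangular in a suitable
  order, so the minor is a pure power of t.\<close>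

lemma chain_mat_minor:
  assumes R: "R \<subseteq> {0..<n}" "card R = i"
    and succ: "\<And>x. x \<in> R \<Longrightarrow> lab x < m \<Longrightarrow> \<exists>y. linked n lab x y"
  shows "\<exists>f h. (\<forall>r<i. f r < n) \<and> (\<forall>r<i. h r < n) \<and>
    fminor (pmat (chain_mat n lab :: 'a::idom mat)) i f h = monom 1 (card {x \<in> R. lab x < m})"
proof -
  let ?X = "chain_mat n lab :: 'a mat"
  have finR: "finite R" using R finite_subset by blast
  obtain f where f: "bij_betw f {0..<i} R" using ex_bij_betw_nat_finite[OF finR] R by auto
  have fR: "f r \<in> R" if "r < i" for r using f that by (auto simp: bij_betw_def)
  have finj: "f r = f c \<Longrightarrow> r = c" if "r < i" "c < i" for r c
    using f that by (auto simp: bij_betw_def dest: inj_onD)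
  have fn: "f r < n" if "r < i" for r using fR[OF that] R by auto
  define h where "h r = (if lab (f r) < m then SOME y. linked n lab (f r) y else f r)" for r
  have h1: "linked n lab (f r) (h r)" if "r < i" "lab (f r) < m" for r
    using someI_ex[OF succ[OF fR[OF that(1)] that(2)]] that by (simp add: h_def)
  have h2: "h r = f r" if "\<not> lab (f r) < m" for r using that by (simp add: h_def)
  have hn: "h r < n" if "r < i" for r
    using h1[OF that] h2[of r] fn[OF that] unfolding linked_def by (cases "lab (f r) < m") auto
  define A where "A = mat i i (\<lambda>(r,c). pmat ?X $$ (f r, h c))"
  have A: "A $$ (r,c) = [: if f r = h c then 1 else 0, if linked n lab (f r) (h c) then 1 else 0 :]"
    if "r < i" "c < i" for r c
    using that fn hn by (simp add: A_def pmat_index[of _ n n]) (simp add: chain_mat_def)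
  have diag: "A $$ (r,r) = monom 1 (if lab (f r) < m then 1 else 0)" if r: "r < i" for r
  proof (cases "lab (f r) < m")
    case True
    have "linked n lab (f r) (h r)" using h1 r True by simp
    moreover from this have "f r \<noteq> h r" unfolding linked_def by simp
    ultimately show ?thesis using A[OF r r] True by (simp add: monom_altdef)
  next
    case False
    have "\<not> linked n lab (f r) (f r)" unfolding linked_def by simp
    then show ?thesis using A[OF r r] False h2[OF False] by (simp add: one_pCons)
  qed
  \<comment> \<open>A nonzero entry off the diagonal joins rows of equal label. For a small label it
    comes from \<open>f r = h c\<close>, whence \<open>f c < f r\<close>; otherwise it is a link
    from \<open>f r\<close> to \<open>f c\<close>, whence \<open>f r < f c\<close>. Therefore the
    sign changes at m.\<close>
  define \<kappa> where "\<kappa> r = (if lab (f r) < m then - int (f r) else int (f r))" for r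
  have "det A = (\<Prod>r=0..<i. A $$ (r,r))"
  proof (rule det_acyclic[of _ _ \<kappa>])
    show "A \<in> carrier_mat i i" by (simp add: A_def)
    fix r c assume rc: "r < i" "c < i" "r \<noteq> c" "A $$ (r,c) \<noteq> 0"
    show "\<kappa> r < \<kappa> c"
    proof (cases "lab (f c) < m")
      case True
      have l: "linked n lab (f c) (h c)" using h1 rc True by simp
      have "\<not> linked n lab (f r) (h c)" using linked_unique[OF l] finj rc by metis
      then have "f r = h c" using A rc by (auto split: if_splits)
      then show ?thesis using l True unfolding linked_def \<kappa>_def by auto
    next
      case False
      have "f r \<noteq> h c" using h2[OF False] finj rc by metis
      then have "linked n lab (f r) (f c)" using A rc h2[OF False] by (auto split: if_splits)
      then show ?thesis using False unfolding linked_def \<kappa>_def by auto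
    qed
  qed
  also have "\<dots> = (\<Prod>r=0..<i. monom 1 (if lab (f r) < m then 1 else 0))"
    using diag by (intro prod.cong) auto
  also have "\<dots> = monom 1 (\<Sum>r=0..<i. if lab (f r) < m then 1 else 0)"
    by (simp add: prod_monom)
  also have "(\<Sum>r=0..<i. if lab (f r) < m then 1 else 0) = (\<Sum>x\<in>R. if lab x < m then 1 else (0::nat))"
    using sum.reindex_bij_betw[OF f] .
  also have "\<dots> = card {x \<in> R. lab x < m}"
    by (subst sum.inter_filter[OF finR, symmetric]) simp
  finally have "fminor (pmat ?X) i f h = monom 1 (card {x \<in> R. lab x < m})"
    unfolding fminor_def A_def .
  then show ?thesis using fn hn by blast
qed

text \<open>Each label class is a chain with one last element. If there are at least m chains,
  deleting the last elements of those labelled below m leaves n - m rows, and each remaining row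
  with a small label has a successor.\<close>

lemma chain_mat_extremal_minor:
  assumes lab: "lab ` {0..<n} = {0..<M}" and m: "m \<le> n"
  shows "\<exists>f h. (\<forall>r<n-m. f r < n) \<and> (\<forall>r<n-m. h r < n) \<and>
    fminor (pmat (chain_mat n lab :: 'a::idom mat)) (n - m) f h
      = monom 1 (card {x. x < n \<and> lab x < m} - m)"
proof -
  let ?S = "{x. x < n \<and> (\<exists>y. linked n lab x y)}"
  define T where "T = {0..<n} - ?S"
  have finT: "finite T" by (simp add: T_def)
  have inj: "inj_on lab T"
  proof (rule inj_onI)
    fix x y assume "x \<in> T" "y \<in> T" "lab x = lab y"
    then show "x = y" using linked_exists[of x y n lab] linked_exists[of y x n lab]
      by (metis (mono_tags, lifting) DiffE T_def atLeastLessThan_iff linorder_neqE_nat mem_Collect_eq)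
  qed
  have img: "lab ` T = {0..<M}"
  proof
    show "lab ` T \<subseteq> {0..<M}" using lab unfolding T_def by blast
    show "{0..<M} \<subseteq> lab ` T"
    proof
      fix j assume "j \<in> {0..<M}"
      then obtain x0 where x0: "x0 < n" "lab x0 = j" using lab by (metis atLeastLessThan_iff imageE)
      let ?C = "{x. x < n \<and> lab x = j}"
      have C: "finite ?C" "?C \<noteq> {}" using x0 by auto
      have mx: "Max ?C \<in> ?C" by (rule Max_in[OF C])
      define k where "k = Max ?C"
      have k: "k < n" "lab k = j" using mx unfolding k_def by auto
      have "\<not> linked n lab k y" for y
      proof
        assume l: "linked n lab k y"
        then have "y \<le> k" using k unfolding k_def linked_def by (intro Max_ge[OF C(1)]) auto
        then show False using l unfolding linked_def by simp
      qed
      then have "k \<in> T" using k unfolding T_def by auto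
      then show "j \<in> lab ` T" using k(2) by blast
    qed
  qed
  have cT: "card T = M" using card_image[OF inj] img by simp
  have cTm: "card {x \<in> T. lab x < m} = min m M"
  proof -
    have "card {x \<in> T. lab x < m} = card (lab ` {x \<in> T. lab x < m})"
      by (rule card_image[symmetric]) (use inj in \<open>auto simp: inj_on_def\<close>)
    also have "lab ` {x \<in> T. lab x < m} = {0..<min m M}"
    proof -
      have "lab ` {x \<in> T. lab x < m} = lab ` T \<inter> {0..<m}" by auto
      then show ?thesis unfolding img by auto
    qed
    finally show ?thesis by simp
  qed
  show ?thesis
  proof (cases "m \<le> M")
    case True
    define R where "R = {0..<n} - {x \<in> T. lab x < m}"
    have "card R = n - m" unfolding R_def
      by (subst card_Diff_subset) (use finT cTm True in \<open>auto simp: T_def\<close>)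
    moreover have "card {x \<in> R. lab x < m} = card {x. x < n \<and> lab x < m} - m"
    proof -
      have "{x \<in> R. lab x < m} = {x. x < n \<and> lab x < m} - {x \<in> T. lab x < m}"
        unfolding R_def by auto
      then show ?thesis
        by (simp only:) (subst card_Diff_subset, use finT cTm True in \<open>auto simp: T_def\<close>)
    qed
    moreover have "\<exists>y. linked n lab x y" if "x \<in> R" "lab x < m" for x
      using that unfolding R_def T_def by auto
    ultimately show ?thesis
      using chain_mat_minor[of R n "n - m" lab m] unfolding R_def by auto
  next
    case False
    \<comment> \<open>With fewer than m chains all labels are small. Any n - m of the n - M rows
      that have a successor will do; all of them move, in accordance with the exponent n -
      m.\<close>
    have labm: "lab x < m" if "x < n" for x
    proof -
      have "lab x \<in> lab ` {0..<n}" using that by simp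
      then show ?thesis using False unfolding lab by simp
    qed
    have "card ?S = n - M"
    proof -
      have S: "?S = {0..<n} - T" unfolding T_def by auto
      show ?thesis unfolding S
        by (subst card_Diff_subset) (use cT finT in \<open>auto simp: T_def\<close>)
    qed
    then obtain R where R: "R \<subseteq> ?S" "card R = n - m"
      using obtain_subset_with_card_n[of "n - m" ?S] False by (metis diff_le_mono2 nat_le_linear)
    have eq: "{x \<in> R. lab x < m} = R" "{x. x < n \<and> lab x < m} = {0..<n}" using R labm by auto
    have "R \<subseteq> {0..<n}" using R by auto
    moreover have "\<exists>y. linked n lab x y" if "x \<in> R" for x using that R by blast
    ultimately show ?thesis
      using chain_mat_minor[of R n "n - m" lab m, where 'a = 'a] R(2) unfolding eq by simp
  qed
qed

subsection \<open>Block structures\<close>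

text \<open>The position of x in its block. Position b occurs once in each block longer than b, that
  is lambda_(b+1) times, so grouping by \<open>offset\<close> realises the transposed
  partition.\<close>

fun offset :: "nat list \<Rightarrow> nat \<Rightarrow> nat" where
  "offset [] x = x"
| "offset (a # nu) x = (if x < a then x else offset nu (x - a))"

lemma block_of_Nil [simp]: "block_of [] x = 0"
  unfolding block_of_def by (rule card_eq_0_iff[THEN iffD2]) auto

text \<open>Replaces the cardinality in \<open>block_of\<close> by a recursion along nu, on which
  the later inductions rest.\<close>

lemma block_of_Cons [simp]:
  "block_of (a # nu) x = (if x < a then 0 else Suc (block_of nu (x - a)))"
proof (cases "x < a")
  case True
  then have "{b. 1 \<le> b \<and> b \<le> length (a # nu) \<and> sum_list (take b (a # nu)) \<le> x} = {}"
    by (auto simp: take_Cons split: nat.splits)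
  then show ?thesis using True by (simp add: block_of_def)
next
  case False
  let ?B = "{b. 1 \<le> b \<and> b \<le> length nu \<and> sum_list (take b nu) \<le> x - a}"
  have "{b. 1 \<le> b \<and> b \<le> length (a # nu) \<and> sum_list (take b (a # nu)) \<le> x} = insert 1 (Suc ` ?B)"
    (is "?L = _")
  proof (rule Set.set_eqI)
    fix b show "b \<in> ?L \<longleftrightarrow> b \<in> insert 1 (Suc ` ?B)"
    proof (cases b)
      case (Suc b')
      then show ?thesis using False by (cases b') auto
    qed auto
  qed
  moreover have "finite ?B" by (rule finite_subset[of _ "{0..length nu}"]) auto
  moreover have "1 \<notin> Suc ` ?B" by auto
  ultimately show ?thesis using False unfolding block_of_def by (simp add: card_image)
qed

text \<open>Cuts the index range after the first block: the induction step of the counts that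
  follow.\<close>

lemma card_less_split:
  fixes a N :: nat
  shows "card {x. x < a + N \<and> P x} = card {x. x < a \<and> P x} + card {x. x < N \<and> P (x + a)}"
proof -
  have "{x. x < a + N \<and> P x} = {x. x < a \<and> P x} \<union> (\<lambda>x. x + a) ` {x. x < N \<and> P (x + a)}"
  proof (rule Set.set_eqI)
    fix x show "x \<in> {x. x < a + N \<and> P x} \<longleftrightarrow>
        x \<in> {x. x < a \<and> P x} \<union> (\<lambda>x. x + a) ` {x. x < N \<and> P (x + a)}"
      by (cases "x < a") (auto simp: image_iff intro!: exI[of _ "x - a"])
  qed
  moreover have "{x. x < a \<and> P x} \<inter> (\<lambda>x. x + a) ` {x. x < N \<and> P (x + a)} = {}" by auto
  ultimately show ?thesis by (simp add: card_Un_disjoint card_image inj_on_def)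
qed

lemma block_of_less: "x < sum_list nu \<Longrightarrow> block_of nu x < length nu"
  by (induction nu arbitrary: x) auto

lemma offset_less: "x < sum_list nu \<Longrightarrow> offset nu x < sum_list nu"
  by (induction nu arbitrary: x) (auto simp: trans_less_add2)

lemma sum_min_card_block:
  "(\<Sum>b<length nu. min m (card {x. x < sum_list nu \<and> block_of nu x = b})) = (\<Sum>v\<leftarrow>nu. min m v)"
proof (induction nu)
  case (Cons a nu)
  have "card {x. x < sum_list (a # nu) \<and> block_of (a # nu) x = b} =
      (case b of 0 \<Rightarrow> a | Suc b' \<Rightarrow> card {x. x < sum_list nu \<and> block_of nu x = b'})" for b
    unfolding sum_list.Cons by (subst card_less_split) (auto split: nat.splits)
  then show ?case using Cons by (simp add: sum.lessThan_Suc_shift del: sum.lessThan_Suc)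
qed simp

lemma card_block_less: "card {x. x < sum_list nu \<and> block_of nu x < m} = sum_list (take m nu)"
proof (induction nu arbitrary: m)
  case (Cons a nu)
  show ?case unfolding sum_list.Cons
    by (subst card_less_split) (use Cons in \<open>auto simp: take_Cons split: nat.splits\<close>)
qed simp

lemma card_offset_eq: "card {x. x < sum_list nu \<and> offset nu x = b} = length (filter (\<lambda>v. b < v) nu)"
proof (induction nu)
  case (Cons a nu)
  have "{x. x < a \<and> offset (a # nu) x = b} = (if b < a then {b} else {})" by auto
  then show ?case unfolding sum_list.Cons
    by (subst card_less_split) (use Cons in auto)
qed simp

text \<open>A block of size v contributes its first min(m, v) positions; the total is lambda_1 + ...
  + lambda_m.\<close>

lemma card_offset_less: "card {x. x < sum_list nu \<and> offset nu x < m} = (\<Sum>v\<leftarrow>nu. min m v)"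
proof (induction nu)
  case (Cons a nu)
  have "{x. x < a \<and> offset (a # nu) x < m} = {0..<min m a}" by auto
  then show ?case unfolding sum_list.Cons
    by (subst card_less_split) (use Cons in auto)
qed simp

lemma image_less_split:
  fixes a N :: nat
  shows "g ` {0..<a + N} = g ` {0..<a} \<union> (\<lambda>x. g (x + a)) ` {0..<N}"
proof -
  have "{0..<a + N} = {0..<a} \<union> (\<lambda>x. x + a) ` {0..<N}"
    by (simp add: ivl_disj_un_two(3) add.commute)
  then show ?thesis by (simp only: image_Un image_image)
qed

lemma block_of_image:
  "\<forall>v\<in>set nu. 0 < v \<Longrightarrow> block_of nu ` {0..<sum_list nu} = {0..<length nu}"
proof (induction nu)
  case (Cons a nu)
  have "block_of (a # nu) ` {0..<sum_list (a # nu)} =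
      block_of (a # nu) ` {0..<a} \<union> Suc ` (block_of nu ` {0..<sum_list nu})"
    unfolding sum_list.Cons image_less_split by (simp add: image_image)
  also have "block_of (a # nu) ` {0..<a} = {0}" using Cons.prems by (force simp: image_def)
  finally show ?case using Cons
    by (auto simp: image_Suc_atLeastLessThan simp del: block_of_Cons)
qed simp

lemma offset_image: "\<exists>M. offset nu ` {0..<sum_list nu} = {0..<M}"
proof (induction nu)
  case Nil
  then show ?case by (intro exI[of _ 0]) simp
next
  case (Cons a nu)
  then obtain M where M: "offset nu ` {0..<sum_list nu} = {0..<M}" by blast
  have "offset (a # nu) ` {0..<a} = {0..<a}" by force
  moreover have "(\<lambda>x. offset (a # nu) (x + a)) = offset nu" by auto
  ultimately have "offset (a # nu) ` {0..<sum_list (a # nu)} = {0..<max a M}"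
    unfolding sum_list.Cons image_less_split using M by (simp add: ivl_disj_un) auto
  then show ?case by blast
qed

lemma offset_inj_block:
  "r < c \<Longrightarrow> c < sum_list nu \<Longrightarrow> offset nu r = offset nu c \<Longrightarrow> block_of nu r < block_of nu c"
proof (induction nu arbitrary: r c)
  case (Cons a nu)
  show ?case
  proof (cases "r < a")
    case True
    then show ?thesis using Cons.prems by auto
  next
    case False
    then show ?thesis using Cons.prems Cons.IH[of "r - a" "c - a"] by auto
  qed
qed simp

text \<open>An explicit element of Jordan type lambda: a link joins equal positions in different
  blocks, hence leads to a later block, and the chains have lengths lambda_1, lambda_2, and so
  on.\<close>

lemma chain_mat_in_u_P: "chain_mat (sum_list nu) (offset nu) \<in> u_P nu"
  unfolding u_P_def by (auto simp: chain_mat_def linked_def dest: offset_inj_block)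

text \<open>A link for block labels is a step to the right-hand neighbour inside one block, so the
  first block decouples from the rest as in a block diagonal matrix.\<close>

lemma linked_block_Cons:
  "linked (a + N) (block_of (a # nu)) r c \<longleftrightarrow>
    (if r < a then c < a \<and> c = Suc r else a \<le> c \<and> linked N (block_of nu) (r - a) (c - a))"
proof (cases "r < a")
  case True
  then show ?thesis unfolding linked_def
    by (auto simp: less_Suc_eq)
next
  case False
  show ?thesis
  proof (cases "c < a")
    case True
    then show ?thesis using False by (simp add: linked_def)
  next
    case ca: False
    have "(\<forall>q. r < q \<and> q < c \<longrightarrow> block_of (a # nu) q \<noteq> block_of (a # nu) r) \<longleftrightarrow>
      (\<forall>q. r - a < q \<and> q < c - a \<longrightarrow> block_of nu q \<noteq> block_of nu (r - a))" (is "?L = ?R")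
    proof
      assume L: ?L
      show ?R
      proof (intro allI impI)
        fix q assume "r - a < q \<and> q < c - a"
        then have "r < q + a \<and> q + a < c" by linarith
        then show "block_of nu q \<noteq> block_of nu (r - a)"
          using L[rule_format, of "q + a"] False by auto
      qed
    next
      assume R: ?R
      show ?L
      proof (intro allI impI)
        fix q assume q: "r < q \<and> q < c"
        then have "r - a < q - a \<and> q - a < c - a" using False by linarith
        with q show "block_of (a # nu) q \<noteq> block_of (a # nu) r"
          using R[rule_format, of "q - a"] False by auto
      qed
    qed
    then show ?thesis using False ca unfolding linked_def by auto
  qed
qed

text \<open>Makes the position inside a Jordan block a level function for the degree bound.\<close>

lemma linked_block_offset:
  "linked (sum_list nu) (block_of nu) r c \<Longrightarrow> offset nu c = Suc (offset nu r)"
proof (induction nu arbitrary: r c)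
  case (Cons a nu)
  then show ?case unfolding sum_list.Cons linked_block_Cons by (auto split: if_splits)
qed (simp add: linked_def)

section \<open>Nilpotent Jordan matrices as chain matrices\<close>

abbreviation nil_jordan :: "nat list \<Rightarrow> 'a::field mat" where
  "nil_jordan mu \<equiv> jordan_matrix (map (\<lambda>s. (s, 0)) mu)"

lemma nil_jordan_carrier: "nil_jordan mu \<in> carrier_mat (sum_list mu) (sum_list mu)"
  using jordan_matrix_carrier[of "map (\<lambda>s. (s, 0)) mu"] by (simp add: o_def)

lemma nil_jordan_chain: "nil_jordan mu = chain_mat (sum_list mu) (block_of mu)"
proof (induction mu)
  case Nil
  then show ?case by (simp add: jordan_matrix_def chain_mat_def) auto
next
  case (Cons a mu)
  have s: "sum_list (map fst (map (\<lambda>s. (s, 0::'a)) mu)) = sum_list mu" by (simp add: o_def)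
  show ?case unfolding list.map jordan_matrix_Cons s Cons.IH sum_list.Cons
    by (rule eq_matI) (auto simp: chain_mat_def linked_block_Cons simp del: block_of_Cons)
qed

lemma sum_length_filter:
  "(\<forall>v\<in>set nu. v \<le> B) \<Longrightarrow> (\<Sum>b<B. length (filter (\<lambda>v. b < v) nu)) = sum_list nu"
proof (induction nu)
  case (Cons a nu)
  have "length (filter (\<lambda>v. b < v) (a # nu)) =
      (if b < a then 1 else 0) + length (filter (\<lambda>v. b < v) nu)" for b by simp
  moreover have "(\<Sum>b<B. if b < a then 1 else 0) = a"
  proof -
    have "{b. b < B \<and> b < a} = {..<a}" using Cons.prems by auto
    then show ?thesis by (subst sum.inter_filter[symmetric]) auto
  qed
  ultimately show ?case using Cons by (simp add: sum.distrib del: filter.simps)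
qed simp

text \<open>In a decreasing list the entries above b form an initial segment. So cutting the columns
  of the diagram of mu at height m gives the columns of its first m rows.\<close>

lemma min_length_filter:
  "sorted_wrt (\<ge>) mu \<Longrightarrow> min m (length (filter (\<lambda>v. b < v) mu)) = length (filter (\<lambda>v. b < v) (take m mu))"
  for mu :: "nat list"
proof (induction mu arbitrary: m)
  case (Cons a mu)
  show ?case
  proof (cases "b < a")
    case True
    then show ?thesis using Cons by (cases m) auto
  next
    case False
    then have "\<forall>v\<in>set (a # mu). \<not> b < v" using Cons.prems by auto
    moreover then have "\<forall>v\<in>set (take m (a # mu)). \<not> b < v" by (meson in_set_takeD)
    ultimately show ?thesis by (simp only: filter_False) simp
  qed
qed simp

lemma member_le_sum_list_nat: "v \<in> set nu \<Longrightarrow> v \<le> sum_list nu" for v :: nat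
  by (induction nu) auto

lemma degree_fminor_nil_jordan:
  assumes mu: "sorted_wrt (\<ge>) mu" and n: "n = sum_list mu" and m: "m \<le> n"
    and f: "\<And>r. r < n - m \<Longrightarrow> f r < n" and h: "\<And>r. r < n - m \<Longrightarrow> h r < n"
  shows "degree (fminor (pmat (nil_jordan mu :: 'a::field mat)) (n - m) f h) \<le> sum_list (take m mu) - m"
proof -
  have "degree (fminor (pmat (nil_jordan mu :: 'a mat)) (n - m) f h) \<le>
     (\<Sum>b<n. min (n - (n - m)) (card {x. x < n \<and> offset mu x = b})) - (n - (n - m))"
  proof (rule degree_fminor_le_levels)
    fix r c assume "r < n" "c < n" "nil_jordan mu $$ (r,c) \<noteq> (0::'a)"
    then have "linked n (block_of mu) r c" unfolding nil_jordan_chain n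
      by (auto simp: chain_mat_def split: if_splits)
    then show "offset mu r < offset mu c" using linked_block_offset n by fastforce
  qed (use n nil_jordan_carrier offset_less f h in auto)
  also have "n - (n - m) = m" using m by simp
  \<comment> \<open>The columns of the first m rows add up to the size of these rows; b < n covers
    all columns since no part exceeds n.\<close>
  also have "(\<Sum>b<n. min m (card {x. x < n \<and> offset mu x = b})) = sum_list (take m mu)"
    unfolding n card_offset_eq min_length_filter[OF mu]
    by (rule sum_length_filter) (auto intro: member_le_sum_list_nat dest: in_set_takeD)
  finally show ?thesis .
qed

lemma extremal_minor_nil_jordan:
  assumes mu: "\<forall>v\<in>set mu. 0 < v" and n: "n = sum_list mu" and m: "m \<le> n"
  shows "\<exists>f h. (\<forall>r<n-m. f r < n) \<and> (\<forall>r<n-m. h r < n) \<and>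
    fminor (pmat (nil_jordan mu :: 'a::field mat)) (n - m) f h = monom 1 (sum_list (take m mu) - m)"
  using chain_mat_extremal_minor[OF block_of_image[OF mu] m[unfolded n]]
  unfolding nil_jordan_chain n card_block_less .

lemma degree_fminor_u_P:
  fixes X :: "'a::field mat"
  assumes X: "X \<in> u_P nu" and n: "n = sum_list nu" and m: "m \<le> n"
    and f: "\<And>r. r < n - m \<Longrightarrow> f r < n" and h: "\<And>r. r < n - m \<Longrightarrow> h r < n"
  shows "degree (fminor (pmat X) (n - m) f h) \<le> (\<Sum>v\<leftarrow>nu. min m v) - m"
proof -
  have "degree (fminor (pmat X) (n - m) f h) \<le>
     (\<Sum>b<length nu. min (n - (n - m)) (card {x. x < n \<and> block_of nu x = b})) - (n - (n - m))"
  proof (rule degree_fminor_le_levels)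
    fix r c assume "r < n" "c < n" "X $$ (r,c) \<noteq> 0"
    then show "block_of nu r < block_of nu c" using X n unfolding u_P_def by (auto simp: not_le[symmetric])
  qed (use X n block_of_less f h in \<open>auto simp: u_P_def\<close>)
  then show ?thesis using m unfolding n sum_min_card_block by simp
qed

text \<open>One and the same matrix makes the bound sharp for every m; only the rows and columns
  depend on m.\<close>

lemma extremal_minor_u_P:
  assumes n: "n = sum_list nu" and m: "m \<le> n"
  shows "\<exists>f h. (\<forall>r<n-m. f r < n) \<and> (\<forall>r<n-m. h r < n) \<and>
    fminor (pmat (chain_mat n (offset nu) :: 'a::field mat)) (n - m) f h
      = monom 1 ((\<Sum>v\<leftarrow>nu. min m v) - m)"
proof -
  obtain M where "offset nu ` {0..<sum_list nu} = {0..<M}" using offset_image by blast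
  from chain_mat_extremal_minor[OF this m[unfolded n]] show ?thesis
    unfolding n card_offset_less .
qed

subsection \<open>Jordan form on the nilradical\<close>

text \<open>Double counting: lambda_j counts the blocks of size at least j, so a block of size v is
  met for min(m, v) values of j.\<close>

lemma sum_lam: "(\<Sum>j\<in>{1..m}. lam nu j) = (\<Sum>v\<leftarrow>nu. min m v)"
proof (induction nu)
  case Nil
  then show ?case by (simp add: lam_def)
next
  case (Cons a nu)
  have "(\<Sum>j\<in>{1..m}. if j \<le> a then 1 else 0) = min m a"
  proof -
    have "{j \<in> {1..m}. j \<le> a} = {1..min m a}" by auto
    then show ?thesis by (subst sum.inter_filter[symmetric]) auto
  qed
  moreover have "lam (a # nu) j = (if j \<le> a then 1 else 0) + lam nu j" for j by (simp add: lam_def)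
  ultimately show ?case using Cons by (simp add: sum.distrib)
qed

lemma sum_list_min_le: "(\<Sum>v\<leftarrow>nu. min m v) \<le> sum_list nu" for m :: nat
  by (induction nu) auto

lemma sum_list_min_total: "sum_list nu \<le> m \<Longrightarrow> (\<Sum>v\<leftarrow>nu. min m v) = sum_list nu" for m :: nat
  by (induction nu) auto

text \<open>Makes the truncated subtraction of m from this sum exact. If the first block is shorter
  than m, the others cover the missing m - a.\<close>

lemma le_sum_list_min: "m \<le> sum_list nu \<Longrightarrow> m \<le> (\<Sum>v\<leftarrow>nu. min m v)" for m :: nat
proof (induction nu arbitrary: m)
  case (Cons a nu)
  have "m - a \<le> (\<Sum>v\<leftarrow>nu. min (m - a) v)" using Cons by simp
  also have "\<dots> \<le> (\<Sum>v\<leftarrow>nu. min m v)" by (rule sum_list_mono) auto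
  finally show ?case by simp
qed simp

text \<open>The lambda_j up to n add up to n, so the tail in \<open>d_lam\<close> is n minus a head,
  and the head is a sum of minima.\<close>

lemma d_lam_eq:
  assumes i: "i \<le> sum_list nu"
  shows "d_lam nu i = (\<Sum>v\<leftarrow>nu. min (sum_list nu - i) v) - (sum_list nu - i)"
proof -
  let ?n = "sum_list nu"
  have eq: "{1..?n} = {1..?n - i} \<union> {?n - i + 1..?n}" by auto
  have "(\<Sum>j\<in>{1..?n}. lam nu j) = (\<Sum>j\<in>{1..?n - i}. lam nu j) + (\<Sum>j\<in>{?n - i + 1..?n}. lam nu j)"
    by (subst eq, rule sum.union_disjoint) auto
  then have "(\<Sum>j\<in>{?n - i + 1..?n}. lam nu j) = ?n - (\<Sum>v\<leftarrow>nu. min (?n - i) v)"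
    by (simp only: sum_lam sum_list_min_total[OF order_refl] diff_add_inverse)
  then show ?thesis unfolding d_lam_def using sum_list_min_le[of "?n - i" nu] i by simp
qed

section \<open>The degrees add up to the dimension of G/P\<close>

lemma two_sum_min: "v \<le> n \<Longrightarrow> 2 * (\<Sum>m<n. int (min m v)) = 2 * int v * int n - int v ^ 2 - int v"
proof (induction n rule: nat_induct_at_least[of v])
  case base
  have "2 * (\<Sum>m<v. int m) = int v ^ 2 - int v"
    by (induction v) (auto simp: power2_eq_square algebra_simps)
  then show ?case by (simp add: power2_eq_square)
next
  case (Suc n)
  then show ?case by (simp add: algebra_simps)
qed

lemma two_dim_G_mod_P: "2 * int (dim_G_mod_P nu) = int (sum_list nu) ^ 2 - (\<Sum>v\<leftarrow>nu. int v ^ 2)"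
proof (induction nu)
  case Nil
  then show ?case by (simp add: dim_G_mod_P_def)
next
  case (Cons a nu)
  have "dim_G_mod_P (a # nu) = (\<Sum>j<length nu. a * nu ! j) + dim_G_mod_P nu"
    unfolding dim_G_mod_P_def by (simp add: sum.lessThan_Suc_shift del: sum.lessThan_Suc cong: if_cong)
  also have "(\<Sum>j<length nu. a * nu ! j) = a * sum_list nu"
    by (simp add: sum_list_sum_nth sum_distrib_left atLeast0LessThan)
  finally show ?case using Cons by (simp add: power2_eq_square algebra_simps)
qed

text \<open>Both sides are doubled and taken over the integers, where each becomes n^2 minus the sum
  of the squares of the block sizes.\<close>

lemma sum_d_lam: "(\<Sum>i\<in>{1..<sum_list nu}. d_lam nu i) = dim_G_mod_P nu"
proof -
  let ?n = "sum_list nu" and ?S = "\<lambda>m. \<Sum>v\<leftarrow>nu. min m v"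
  have "(\<Sum>i\<in>{1..<?n}. d_lam nu i) = (\<Sum>m\<in>{1..<?n}. ?S m - m)"
    by (rule sum.reindex_bij_witness[of _ "\<lambda>m. ?n - m" "\<lambda>m. ?n - m"]) (auto simp: d_lam_eq)
  \<comment> \<open>The added term m = 0 is zero; with it the closed formula for the minima
    applies.\<close>
  also have "\<dots> = (\<Sum>m<?n. ?S m - m)"
    by (rule sum.mono_neutral_left) (auto simp: not_le)
  finally have "2 * int (\<Sum>i\<in>{1..<?n}. d_lam nu i) = 2 * (\<Sum>m<?n. int (?S m - m))" by simp
  also have "\<dots> = 2 * (\<Sum>m<?n. int (?S m)) - 2 * (\<Sum>m<?n. int m)"
    unfolding right_diff_distrib[symmetric] sum_subtractf[symmetric]
    using le_sum_list_min by (intro arg_cong[of _ _ "(*) 2"] sum.cong) (auto simp: of_nat_diff)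
  also have "2 * (\<Sum>m<?n. int m) = int ?n ^ 2 - int ?n"
    using two_sum_min[of ?n ?n] by (simp add: power2_eq_square)
  also have "2 * (\<Sum>m<N. int (\<Sum>v\<leftarrow>nu. min m v)) = 2 * int ?n * int N - (\<Sum>v\<leftarrow>nu. int v ^ 2) - int ?n"
    if "?n \<le> N" for N
    using that
  proof (induction nu)
    case (Cons a nu)
    then show ?case using two_sum_min[of a N] by (simp add: sum.distrib algebra_simps)
  qed simp
  finally show ?thesis using two_dim_G_mod_P[of nu] by (simp add: power2_eq_square del: of_nat_sum)
qed

section \<open>Reordering Jordan blocks\<close>

lemma similar_mat_reindex:
  fixes A B :: "'a::field mat"
  assumes A: "A \<in> carrier_mat n n" and B: "B \<in> carrier_mat n n"
    and pi: "inj_on \<pi> {0..<n}" "\<And>r. r < n \<Longrightarrow> \<pi> r < n"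
    and eq: "\<And>r c. r < n \<Longrightarrow> c < n \<Longrightarrow> B $$ (r,c) = A $$ (\<pi> r, \<pi> c)"
  shows "similar_mat B A"
proof -
  define P :: "'a mat" where "P = mat n n (\<lambda>(r,c). if c = \<pi> r then 1 else 0)"
  define Q :: "'a mat" where "Q = mat n n (\<lambda>(r,c). if r = \<pi> c then 1 else 0)"
  have P: "P \<in> carrier_mat n n" and Q: "Q \<in> carrier_mat n n" by (auto simp: P_def Q_def)
  have PQ: "P * Q = 1\<^sub>m n"
    by (rule eq_matI)
      (use pi in \<open>auto simp: P_def Q_def scalar_prod_def if_distrib[of "\<lambda>x. x * _"] inj_on_eq_iff cong: if_cong\<close>)
  have PA: "P * A = mat n n (\<lambda>(r,c). A $$ (\<pi> r, c))"
    by (rule eq_matI)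
      (use A pi in \<open>auto simp: P_def scalar_prod_def if_distrib[of "\<lambda>x. x * _"] cong: if_cong\<close>)
  have "B = P * A * Q" unfolding PA
    by (rule eq_matI)
      (use B pi eq in \<open>auto simp: Q_def scalar_prod_def if_distrib[of "\<lambda>x. _ * x"] cong: if_cong\<close>)
  then show ?thesis unfolding similar_mat_def similar_mat_wit_def Let_def
    using A B P Q PQ mat_mult_left_right_inverse[OF P Q PQ] by (intro exI[of _ P] exI[of _ Q]) auto
qed

text \<open>The reindexing moves the leading block of size b behind the one of size a and leaves all
  later indices in place.\<close>

lemma nil_jordan_swap:
  "similar_mat (nil_jordan (b # a # mu) :: 'a::field mat) (nil_jordan (a # b # mu))"
proof (rule similar_mat_reindex[where n = "a + b + sum_list mu"
      and \<pi> = "\<lambda>x. if x < b then x + a else if x < a + b then x - b else x"])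
  show "(nil_jordan (b # a # mu) :: 'a mat) \<in> carrier_mat (a + b + sum_list mu) (a + b + sum_list mu)"
    using nil_jordan_carrier[of "b # a # mu"] by (simp add: ac_simps)
  show "(nil_jordan (a # b # mu) :: 'a mat) \<in> carrier_mat (a + b + sum_list mu) (a + b + sum_list mu)"
    using nil_jordan_carrier[of "a # b # mu"] by (simp add: ac_simps)
  show "inj_on (\<lambda>x. if x < b then x + a else if x < a + b then x - b else x) {0..<a + b + sum_list mu}"
    by (auto simp: inj_on_def split: if_splits)
  fix r c assume rc: "r < a + b + sum_list mu" "c < a + b + sum_list mu"
  have "linked (sum_list (b # a # mu)) (block_of (b # a # mu)) r c \<longleftrightarrow>
    linked (sum_list (a # b # mu)) (block_of (a # b # mu))
     (if r < b then r + a else if r < a + b then r - b else r)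
     (if c < b then c + a else if c < a + b then c - b else c)"
    using rc unfolding sum_list.Cons linked_block_Cons by (auto simp: diff_diff_add add.commute)
  then show "nil_jordan (b # a # mu) $$ (r,c) = (nil_jordan (a # b # mu) :: 'a mat) $$
     (if r < b then r + a else if r < a + b then r - b else r,
      if c < b then c + a else if c < a + b then c - b else c)"
    using rc unfolding nil_jordan_chain by (auto simp: chain_mat_def)
qed auto

lemma nil_jordan_Cons_similar:
  assumes sim: "similar_mat (nil_jordan mu :: 'a::field mat) (nil_jordan mu')"
    and sum: "sum_list mu = sum_list mu'"
  shows "similar_mat (nil_jordan (a # mu) :: 'a mat) (nil_jordan (a # mu'))"
proof -
  have s: "sum_list (map fst (map (\<lambda>s. (s, 0::'a)) mu)) = sum_list mu" for mu by (simp add: o_def)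
  show ?thesis unfolding list.map jordan_matrix_Cons s sum
    by (rule similar_mat_four_block_0_0[OF similar_mat_refl sim])
      (use nil_jordan_carrier[of mu] sum in auto)
qed

lemma nil_jordan_insort:
  "similar_mat (nil_jordan (a # mu) :: 'a::field mat) (nil_jordan (insort_key k a mu))"
proof (induction mu)
  case Nil
  show ?case using similar_mat_refl[OF nil_jordan_carrier[of "[a]"]] by simp
next
  case (Cons b mu)
  have "sum_list (insort_key k a mu) = sum_list (a # mu)"
    by (induction mu) auto
  with Cons have "similar_mat (nil_jordan (b # a # mu) :: 'a mat) (nil_jordan (b # insort_key k a mu))"
    by (intro nil_jordan_Cons_similar) auto
  with nil_jordan_swap[of a b mu]
  have "similar_mat (nil_jordan (a # b # mu) :: 'a mat) (nil_jordan (b # insort_key k a mu))"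
    by (rule similar_mat_trans)
  then show ?case using similar_mat_refl[OF nil_jordan_carrier[of "a # b # mu", where 'a = 'a]] by simp
qed

lemma nil_jordan_sort: "similar_mat (nil_jordan mu :: 'a::field mat) (nil_jordan (sort_key k mu))"
proof (induction mu)
  case Nil
  show ?case using similar_mat_refl[OF nil_jordan_carrier[of "[]"]] by simp
next
  case (Cons a mu)
  have "sum_list (sort_key k mu) = sum_list mu"
    by (metis mset_sort sum_mset_sum_list)
  with Cons have "similar_mat (nil_jordan (a # mu) :: 'a mat) (nil_jordan (a # sort_key k mu))"
    by (intro nil_jordan_Cons_similar) auto
  then show ?case using nil_jordan_insort[of a "sort_key k mu" k] similar_mat_trans by fastforce
qed

text \<open>Elements of the nilradical are upper triangular, which yields a Jordan form over the
  given field, and the characteristic polynomial t^n leaves 0 as the only eigenvalue. The decreasing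
  order makes the partial sums of mu comparable with those of lambda.\<close>

lemma u_P_similar_nil_jordan:
  assumes X: "X \<in> u_P nu"
  shows "\<exists>mu. sorted_wrt (\<ge>) mu \<and> (\<forall>v\<in>set mu. 0 < v) \<and> sum_list mu = sum_list nu \<and>
    similar_mat X (nil_jordan mu :: 'a::field mat)"
proof -
  let ?n = "sum_list nu"
  have XC: "X \<in> carrier_mat ?n ?n" using X by (simp add: u_P_def)
  have mono: "r \<le> c \<Longrightarrow> block_of nu r \<le> block_of nu c" for r c
    unfolding block_of_def by (intro card_mono) (auto intro: finite_subset[of _ "{0..length nu}"])
  have zero: "X $$ (r,c) = 0" if "r < ?n" "c \<le> r" for r c
    using that X mono[of c r] unfolding u_P_def by auto
  have "upper_triangular X" using zero XC by (intro upper_triangularI) auto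
  from triangular_to_jnf_vector[OF XC this] obtain nas where nas: "jordan_nf X nas" by blast
  have "(\<Prod>a\<leftarrow>diag_mat X. [:- a, 1:]) = (\<Prod>(s, a)\<leftarrow>nas. [:- a, 1:] ^ s)"
    using jordan_nf_char_poly[OF nas] char_poly_upper_triangular[OF XC \<open>upper_triangular X\<close>] by simp
  moreover have "diag_mat X = replicate ?n 0"
    unfolding diag_mat_def using XC zero by (intro nth_equalityI) auto
  ultimately have cp: "(\<Prod>(s, a)\<leftarrow>nas. [:- a, 1:] ^ s) = [:0, 1:] ^ ?n" by simp
  have ev: "a = 0" if mem: "(s, a) \<in> set nas" for s a
  proof -
    have s: "s \<noteq> 0" using nas mem unfolding jordan_nf_def by force
    have "poly (\<Prod>(s, a)\<leftarrow>nas. [:- a, 1:] ^ s) a = 0"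
      using mem s by (induction nas) auto
    then show ?thesis unfolding cp by simp
  qed
  define mu where "mu = map fst nas"
  have nas_mu: "nas = map (\<lambda>s. (s, 0)) mu" unfolding mu_def using ev by (induction nas) auto
  \<comment> \<open>\<open>sort_key\<close> sorts increasingly; the negated integer key gives a
    decreasing list.\<close>
  let ?mu = "sort_key (\<lambda>v. - int v) mu"
  have sim: "similar_mat X (nil_jordan mu)" using nas unfolding jordan_nf_def nas_mu by simp
  have sim': "similar_mat X (nil_jordan ?mu)" by (rule similar_mat_trans[OF sim nil_jordan_sort])
  have "sorted (map (\<lambda>v. - int v) ?mu)" by simp
  then have "sorted_wrt (\<ge>) ?mu" unfolding sorted_map by (simp add: sorted_wrt_mono_rel[rotated])
  moreover have "\<forall>v\<in>set ?mu. 0 < v" using nas unfolding jordan_nf_def mu_def by force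
  moreover have "sum_list ?mu = ?n"
  proof -
    obtain k where "X \<in> carrier_mat k k" "(nil_jordan ?mu :: 'a mat) \<in> carrier_mat k k"
      using similar_matD[OF sim'] by blast
    then show ?thesis using XC nil_jordan_carrier[of ?mu, where 'a = 'a] by (metis carrier_matD(1))
  qed
  ultimately show ?thesis using sim' by blast
qed

subsection \<open>Homogeneous components and the orbit criterion\<close>

text \<open>Over a finite field the product of all t - a, plus 1, has positive degree but takes only
  the value 1.\<close>

lemma alg_closed_infinite:
  assumes "alg_closed_field TYPE('a::field)"
  shows "infinite (UNIV :: 'a set)"
proof
  assume fin: "finite (UNIV :: 'a set)"
  let ?q = "(\<Prod>a\<in>(UNIV :: 'a set). [:- a, 1:]) + 1"
  have deg: "degree (\<Prod>a\<in>(UNIV :: 'a set). [:- a, 1:]) = card (UNIV :: 'a set)"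
    by (subst degree_prod_sum_eq) auto
  have pos: "card (UNIV :: 'a set) > 0" using fin by (simp add: card_gt_0_iff)
  have "degree ?q = card (UNIV :: 'a set)"
    using deg pos by (subst degree_add_eq_left) auto
  then obtain x :: 'a where "poly ?q x = 0"
    using assms pos unfolding alg_closed_field_def by (metis One_nat_def Suc_leI)
  moreover have "poly ?q x = 1"
    using fin by (simp add: poly_prod)
  ultimately show False by simp
qed

text \<open>Gives the uniqueness behind the definite description in \<open>hom_comp\<close>.\<close>

lemma poly_eqI_infinite:
  fixes p q :: "'a::idom poly"
  assumes inf: "infinite (UNIV :: 'a set)" and eq: "\<And>t. poly p t = poly q t"
  shows "p = q"
proof (rule ccontr)
  assume "p \<noteq> q"
  then have "finite {t. poly (p - q) t = 0}" by (intro poly_roots_finite) simp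
  moreover have "{t. poly (p - q) t = 0} = UNIV" using eq by simp
  ultimately show False using inf by simp
qed

section \<open>Conjugation through the adjugate\<close>

lemma invertible_det_nonzero:
  fixes g :: "'a::field mat"
  assumes g: "g \<in> carrier_mat n n" and inv: "invertible_mat g"
  shows "det g \<noteq> 0"
proof -
  obtain B where B: "g * B = 1\<^sub>m (dim_row g)" "B * g = 1\<^sub>m (dim_row B)"
    using inv unfolding invertible_mat_def inverts_mat_def by blast
  have "dim_col B = n" "dim_row B = n"
    using arg_cong[OF B(1), of dim_col] arg_cong[OF B(2), of dim_col] g by auto
  then have "B \<in> carrier_mat n n" by auto
  from det_mult[OF g this] B(1) g show ?thesis by auto
qed

lemma adj_inverse:
  fixes g :: "'a::field mat"
  assumes g: "g \<in> carrier_mat n n" and d: "det g \<noteq> 0"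
  shows "inverse (det g) \<cdot>\<^sub>m adj_mat g \<in> carrier_mat n n"
    and "g * (inverse (det g) \<cdot>\<^sub>m adj_mat g) = 1\<^sub>m n"
    and "(inverse (det g) \<cdot>\<^sub>m adj_mat g) * g = 1\<^sub>m n"
proof -
  note a = adj_mat[OF g]
  show c: "inverse (det g) \<cdot>\<^sub>m adj_mat g \<in> carrier_mat n n" using a by simp
  show "g * (inverse (det g) \<cdot>\<^sub>m adj_mat g) = 1\<^sub>m n"
    unfolding mult_smult_distrib[OF g a(1)] a(2) using d by (intro eq_matI) auto
  show "(inverse (det g) \<cdot>\<^sub>m adj_mat g) * g = 1\<^sub>m n"
    unfolding mult_smult_assoc_mat[OF a(1) g] a(3) using d by (intro eq_matI) auto
qed

lemma det_nonzero_invertible: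
  fixes g :: "'a::field mat"
  assumes g: "g \<in> carrier_mat n n" and d: "det g \<noteq> 0"
  shows "invertible_mat g"
  unfolding invertible_mat_def inverts_mat_def
  using adj_inverse[OF g d] g by (auto intro!: exI[of _ "inverse (det g) \<cdot>\<^sub>m adj_mat g"])

lemma phi_carrier:
  assumes "g \<in> carrier_mat n n" "X \<in> carrier_mat n n"
  shows "phi g X \<in> carrier_mat n n"
  using assms adj_mat(1)[of g n] unfolding phi_def by auto

lemma phi_similar:
  assumes g: "g \<in> carrier_mat n n" and d: "det g \<noteq> 0" and X: "X \<in> carrier_mat n n"
  shows "similar_mat (phi g X) X"
  unfolding similar_mat_def similar_mat_wit_def Let_def
  using phi_carrier[OF g X] adj_inverse[OF g d] g X
  by (intro exI[of _ g] exI[of _ "inverse (det g) \<cdot>\<^sub>m adj_mat g"]) (auto simp: phi_def)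

lemma phi_smult:
  assumes g: "g \<in> carrier_mat n n" and X: "X \<in> carrier_mat n n"
  shows "phi g (t \<cdot>\<^sub>m X) = t \<cdot>\<^sub>m phi g X"
proof -
  have c: "inverse (det g) \<cdot>\<^sub>m adj_mat g \<in> carrier_mat n n" using adj_mat(1)[OF g] by simp
  show ?thesis unfolding phi_def mult_smult_distrib[OF g X]
    by (rule mult_smult_assoc_mat[OF _ c]) (use g X in auto)
qed

lemma det_lead_pmat:
  assumes Y: "Y \<in> carrier_mat n n" and i: "i \<le> n"
  shows "det (pmat (lead_sub Y i)) = fminor (pmat Y) i (\<lambda>r. r) (\<lambda>r. r)"
proof -
  have "pmat (lead_sub Y i) = mat i i (\<lambda>(r,c). pmat Y $$ (r,c))"
    by (rule eq_matI) (use Y i in \<open>auto simp: pmat_def lead_sub_def\<close>)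
  then show ?thesis by (simp add: fminor_def)
qed

lemma poly_det_pmat:
  assumes Y: "Y \<in> carrier_mat n n" and i: "i \<le> n"
  shows "poly (det (pmat (lead_sub Y i))) t = det (lead_sub (1\<^sub>m n + t \<cdot>\<^sub>m Y) i)"
proof -
  have h: "comm_ring_hom (\<lambda>q. poly q t)" by unfold_locales auto
  have "map_mat (\<lambda>q. poly q t) (pmat (lead_sub Y i)) = lead_sub (1\<^sub>m n + t \<cdot>\<^sub>m Y) i"
    by (rule eq_matI) (use Y i in \<open>auto simp: pmat_def lead_sub_def\<close>)
  then show ?thesis using comm_ring_hom.hom_det[OF h, of "pmat (lead_sub Y i)"] by simp
qed

text \<open>Scaling X by t scales \<open>phi g X\<close> by t, so the i-th factor of F is the value
  at t of the determinant of 1 + tY on the leading block. This makes the polynomial in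
  \<open>hom_comp\<close> explicit.\<close>

lemma hom_comp_power_F_KLT:
  fixes X :: "'a::field mat"
  assumes inf: "infinite (UNIV :: 'a set)"
    and g: "g \<in> carrier_mat n n" and X: "X \<in> carrier_mat n n"
  shows "hom_comp (\<lambda>g X. F_KLT n (phi g X) ^ k) d g X =
    coeff ((\<Prod>i\<in>{1..<n}. det (pmat (lead_sub (phi g X) i))) ^ k) d"
proof -
  let ?q = "(\<Prod>i\<in>{1..<n}. det (pmat (lead_sub (phi g X) i))) ^ k"
  have eq: "poly ?q t = F_KLT n (phi g (t \<cdot>\<^sub>m X)) ^ k" for t
    unfolding F_KLT_def phi_smult[OF g X] poly_power poly_prod
    using poly_det_pmat[OF phi_carrier[OF g X], of _ t]
    by (intro arg_cong2[of _ _ _ _ "(^)"] prod.cong refl) auto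
  have "(THE q. \<forall>t. poly q t = F_KLT n (phi g (t \<cdot>\<^sub>m X)) ^ k) = ?q"
  proof (rule the_equality)
    show "\<forall>t. poly ?q t = F_KLT n (phi g (t \<cdot>\<^sub>m X)) ^ k" using eq by blast
    fix q assume "\<forall>t. poly q t = F_KLT n (phi g (t \<cdot>\<^sub>m X)) ^ k"
    then show "q = ?q" using eq by (intro poly_eqI_infinite[OF inf]) simp
  qed
  then show ?thesis unfolding hom_comp_def by simp
qed

text \<open>The bounds m and n need not be attained. This covers points where a factor of
  \<open>f_lam\<close> vanishes and the degree of its determinant drops.\<close>

lemma coeff_mult_top:
  assumes "degree a \<le> m" "degree b \<le> n"
  shows "coeff (a * b) (m + n) = coeff a m * coeff b n"
proof -
  have "coeff (a * b) (m + n) = (\<Sum>j\<le>m + n. coeff a j * coeff b (m + n - j))"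
    by (rule coeff_mult)
  also have "\<dots> = (\<Sum>j\<in>{m}. coeff a j * coeff b (m + n - j))"
  proof (rule sum.mono_neutral_right)
    show "\<forall>j\<in>{..m + n} - {m}. coeff a j * coeff b (m + n - j) = 0"
    proof
      fix j assume j: "j \<in> {..m + n} - {m}"
      show "coeff a j * coeff b (m + n - j) = 0"
      proof (cases "j < m")
        case True
        then have "degree b < m + n - j" using assms by linarith
        then show ?thesis by (simp add: coeff_eq_0)
      next
        case False
        then have "degree a < j" using assms j by auto
        then show ?thesis by (simp add: coeff_eq_0)
      qed
    qed
  qed auto
  finally show ?thesis by simp
qed

lemma coeff_prod_top:
  assumes "finite I" "\<And>i. i \<in> I \<Longrightarrow> degree (q i) \<le> d i"
  shows "degree (\<Prod>i\<in>I. q i) \<le> (\<Sum>i\<in>I. d i) \<and>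
    coeff (\<Prod>i\<in>I. q i) (\<Sum>i\<in>I. d i) = (\<Prod>i\<in>I. coeff (q i) (d i))"
  using assms
proof (induction I rule: finite_induct)
  case (insert x I)
  then have IH: "degree (\<Prod>i\<in>I. q i) \<le> (\<Sum>i\<in>I. d i)"
    "coeff (\<Prod>i\<in>I. q i) (\<Sum>i\<in>I. d i) = (\<Prod>i\<in>I. coeff (q i) (d i))" by auto
  have x: "degree (q x) \<le> d x" using insert by simp
  have "degree (q x * (\<Prod>i\<in>I. q i)) \<le> d x + (\<Sum>i\<in>I. d i)"
    using degree_mult_le[of "q x" "\<Prod>i\<in>I. q i"] x IH(1) by linarith
  then show ?case using insert.hyps coeff_mult_top[OF x IH(1)] IH(2) by simp
qed simp

lemma coeff_power_top:
  assumes "degree q \<le> d"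
  shows "degree (q ^ k) \<le> k * d \<and> coeff (q ^ k) (k * d) = coeff q d ^ k"
  using coeff_prod_top[of "{0..<k}" "\<lambda>_. q" "\<lambda>_. d"] assms by simp

lemma degree_lead_pmat:
  fixes X :: "'a::field mat"
  assumes X: "X \<in> u_P nu" and sim: "similar_mat Y X" and i: "i \<le> sum_list nu"
  shows "degree (det (pmat (lead_sub Y i))) \<le> d_lam nu i"
proof -
  let ?n = "sum_list nu"
  have XC: "X \<in> carrier_mat ?n ?n" using X by (simp add: u_P_def)
  have Y: "Y \<in> carrier_mat ?n ?n" using similar_matD[OF sim] XC by auto
  have ni: "?n - (?n - i) = i" using i by simp
  show ?thesis unfolding det_lead_pmat[OF Y i] d_lam_eq[OF i]
    using degree_fminor_u_P[OF X refl diff_le_self, of i] i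
    by (intro degree_fminor_similar[OF sim XC]) (auto simp: ni)
qed

lemma s_minor_lead:
  assumes Y: "Y \<in> carrier_mat n n" and i: "i \<le> n"
  shows "s_minor j (lead_sub Y i) = coeff (det (pmat (lead_sub Y i))) j"
  by (rule coeff_det_pmat[symmetric, of _ i]) (simp add: lead_sub_def)

lemma f_lam_eq:
  assumes Y: "Y \<in> carrier_mat (sum_list nu) (sum_list nu)"
  shows "f_lam nu Y = (\<Prod>i\<in>{1..<sum_list nu}. coeff (det (pmat (lead_sub Y i))) (d_lam nu i))"
  unfolding f_lam_def by (intro prod.cong refl) (auto intro!: s_minor_lead[OF Y])

lemma hom_comp_sigma:
  fixes X :: "'a::field mat"
  assumes inf: "infinite (UNIV :: 'a set)" and n: "n = sum_list nu"
    and g: "g \<in> carrier_mat n n" and inv: "invertible_mat g" and X: "X \<in> u_P nu"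
  shows "d > k * dim_G_mod_P nu \<Longrightarrow> hom_comp (\<lambda>g X. F_KLT n (phi g X) ^ k) d g X = 0"
    and "hom_comp (\<lambda>g X. F_KLT n (phi g X) ^ k) (k * dim_G_mod_P nu) g X = f_lam nu (phi g X) ^ k"
proof -
  let ?Q = "\<Prod>i\<in>{1..<n}. det (pmat (lead_sub (phi g X) i))"
  have XC: "X \<in> carrier_mat n n" using X n by (simp add: u_P_def)
  have sim: "similar_mat (phi g X) X"
    by (rule phi_similar[OF g invertible_det_nonzero[OF g inv] XC])
  have "degree ?Q \<le> (\<Sum>i\<in>{1..<n}. d_lam nu i) \<and> coeff ?Q (\<Sum>i\<in>{1..<n}. d_lam nu i) =
      (\<Prod>i\<in>{1..<n}. coeff (det (pmat (lead_sub (phi g X) i))) (d_lam nu i))"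
    using degree_lead_pmat[OF X sim] n by (intro coeff_prod_top) auto
  then have "degree ?Q \<le> dim_G_mod_P nu" "coeff ?Q (dim_G_mod_P nu) = f_lam nu (phi g X)"
    using phi_carrier[OF g XC] f_lam_eq[of "phi g X" nu] n sum_d_lam[of nu] by auto
  then have *: "degree (?Q ^ k) \<le> k * dim_G_mod_P nu"
    "coeff (?Q ^ k) (k * dim_G_mod_P nu) = f_lam nu (phi g X) ^ k"
    using coeff_power_top[of ?Q "dim_G_mod_P nu" k] by auto
  show "hom_comp (\<lambda>g X. F_KLT n (phi g X) ^ k) d g X = 0" if "d > k * dim_G_mod_P nu"
    unfolding hom_comp_power_F_KLT[OF inf g XC] using that * by (intro coeff_eq_0) linarith
  show "hom_comp (\<lambda>g X. F_KLT n (phi g X) ^ k) (k * dim_G_mod_P nu) g X = f_lam nu (phi g X) ^ k"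
    unfolding hom_comp_power_F_KLT[OF inf g XC] using * by simp
qed

lemma length_le_sum_list: "\<forall>v\<in>set mu. 0 < v \<Longrightarrow> length mu \<le> sum_list mu" for mu :: "nat list"
  by (induction mu) auto

text \<open>Consecutive partial sums differ by an entry of mu, or by 0 beyond its end, on one side
  and by lambda_(j+1) on the other.\<close>

lemma lam_list_eq:
  assumes mu: "\<forall>v\<in>set mu. 0 < v" and sum: "sum_list mu = sum_list nu"
    and eq: "\<And>m. m \<le> sum_list nu \<Longrightarrow> sum_list (take m mu) = (\<Sum>v\<leftarrow>nu. min m v)"
  shows "lam_list nu = mu"
proof -
  let ?n = "sum_list nu"
  \<comment> \<open>Extends mu by zeros to length n; the filter in \<open>lam_list\<close> removes
    exactly these.\<close>
  let ?e = "\<lambda>j. if j < length mu then mu ! j else 0"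
  have len: "length mu \<le> ?n" unfolding sum[symmetric] by (rule length_le_sum_list[OF mu])
  have "lam nu (Suc j) = ?e j" if "j < ?n" for j
  proof -
    have "sum_list (take (Suc j) mu) = sum_list (take j mu) + lam nu (Suc j)"
      using that eq[of "Suc j"] eq[of j] sum_lam[of nu "Suc j", symmetric] sum_lam[of nu j, symmetric] by simp
    then show ?thesis by (cases "j < length mu") (auto simp: take_Suc_conv_app_nth)
  qed
  then have "map (lam nu) [1..<?n + 1] = map ?e [0..<?n]"
    by (intro nth_equalityI) (auto simp del: upt_Suc)
  also have "[0..<?n] = [0..<length mu] @ [length mu..<?n]"
    using len by (metis le_add_diff_inverse upt_add_eq_append zero_le)
  also have "map ?e \<dots> = mu @ replicate (?n - length mu) 0"
    by (auto intro!: nth_equalityI simp: nth_append)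
  finally show ?thesis unfolding lam_list_def using mu by simp
qed

lemma nil_orbit_of_f_lam_nonzero:
  fixes X :: "'a::field mat"
  assumes X: "X \<in> u_P nu" and sim: "similar_mat Y X" and nz: "f_lam nu Y \<noteq> 0"
  shows "Y \<in> nil_orbit (lam_list nu)"
proof -
  let ?n = "sum_list nu"
  let ?S = "\<lambda>m. \<Sum>v\<leftarrow>nu. min m v"
  have XC: "X \<in> carrier_mat ?n ?n" using X by (simp add: u_P_def)
  have YC: "Y \<in> carrier_mat ?n ?n" using similar_matD[OF sim] XC by auto
  obtain mu where mu: "sorted_wrt (\<ge>) mu" "\<forall>v\<in>set mu. 0 < v" "sum_list mu = ?n"
    and simX: "similar_mat X (nil_jordan mu)"
    using u_P_similar_nil_jordan[OF X] by blast
  have simY: "similar_mat Y (nil_jordan mu)" by (rule similar_mat_trans[OF sim simX])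
  have JC: "nil_jordan mu \<in> carrier_mat ?n ?n" using nil_jordan_carrier[of mu] mu(3) by simp
  have len: "length mu \<le> ?n" unfolding mu(3)[symmetric] by (rule length_le_sum_list[OF mu(2)])
  have take_ge: "m \<le> sum_list (take m mu)" if m: "m \<le> ?n" for m
  proof (cases "m \<le> length mu")
    case True
    have "\<forall>v\<in>set (take m mu). 0 < v" using mu(2) by (meson in_set_takeD)
    from length_le_sum_list[OF this] True show ?thesis by simp
  next
    case False
    then show ?thesis using m mu(3) by simp
  qed
  have eq: "sum_list (take m mu) = ?S m" if m: "m \<le> ?n" for m
  proof (cases "m = 0 \<or> m = ?n")
    \<comment> \<open>\<open>f_lam\<close> has factors only for 0 < i < n. At m = 0 both sums are 0,
      at m = n both are n.\<close>
    case True
    have "take ?n mu = mu"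
      using len by simp
    then show ?thesis using True sum_list_min_total[of nu ?n] mu(3) by auto
  next
    case False
    define i where "i = ?n - m"
    have i: "1 \<le> i" "i < ?n" "?n - i = m" using False m by (auto simp: i_def)
    \<comment> \<open>Dominance: an extremal minor of the Jordan matrix obeys the bound that its
      similarity to X imposes on all minors.\<close>
    have "sum_list (take m mu) - m \<le> ?S m - m"
    proof -
      obtain f h where fh: "\<And>r. r < ?n - m \<Longrightarrow> f r < ?n" "\<And>r. r < ?n - m \<Longrightarrow> h r < ?n"
        "fminor (pmat (nil_jordan mu :: 'a mat)) (?n - m) f h = monom 1 (sum_list (take m mu) - m)"
        using extremal_minor_nil_jordan[OF mu(2) mu(3)[symmetric] m, where 'a = 'a] by blast
      have "degree (fminor (pmat (nil_jordan mu :: 'a mat)) (?n - m) f h) \<le> ?S m - m"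
        by (rule degree_fminor_similar[OF similar_mat_sym[OF simX] XC])
          (use degree_fminor_u_P[OF X refl m] fh in auto)
      then show ?thesis unfolding fh(3) by (simp add: degree_monom_eq)
    qed
    \<comment> \<open>Conversely, the i-th factor of \<open>f_lam\<close> is the coefficient at
      degree \<open>d_lam nu i\<close>; being nonzero, it forces the Jordan bound to reach that
      degree.\<close>
    moreover have "?S m - m \<le> sum_list (take m mu) - m"
    proof -
      have "coeff (det (pmat (lead_sub Y i))) (d_lam nu i) \<noteq> 0"
        using nz i unfolding f_lam_eq[OF YC] by auto
      then have "d_lam nu i \<le> degree (det (pmat (lead_sub Y i)))" by (rule le_degree)
      also have "\<dots> \<le> sum_list (take m mu) - m"
        unfolding det_lead_pmat[OF YC less_imp_le[OF i(2)]]
      proof (rule degree_fminor_similar[OF simY JC])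
        fix f h :: "nat \<Rightarrow> nat"
        assume "\<And>r. r < i \<Longrightarrow> f r < ?n" "\<And>r. r < i \<Longrightarrow> h r < ?n"
        then show "degree (fminor (pmat (nil_jordan mu :: 'a mat)) i f h) \<le> sum_list (take m mu) - m"
          using degree_fminor_nil_jordan[OF mu(1) mu(3)[symmetric] m, of f h] by (simp add: i_def)
      qed (use i in auto)
      finally show ?thesis using d_lam_eq[of i nu] i by simp
    qed
    ultimately show ?thesis using take_ge[OF m] le_sum_list_min[OF m] by linarith
  qed
  have "lam_list nu = mu" by (rule lam_list_eq[OF mu(2,3) eq])
  then show ?thesis using simY unfolding nil_orbit_def by simp
qed

subsection \<open>Generic conjugates\<close>

definition line_mat :: "nat \<Rightarrow> 'a::comm_ring_1 mat \<Rightarrow> 'a mat \<Rightarrow> 'a \<Rightarrow> 'a mat" where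
  "line_mat n A B t = mat n n (\<lambda>(r,c). (1 - t) * A $$ (r,c) + t * B $$ (r,c))"

text \<open>A stand-in for regular functions on matrices, stable under sums and products and
  tailored to joining two points by a line.\<close>

definition line_poly :: "nat \<Rightarrow> ('a::comm_ring_1 mat \<Rightarrow> 'a) \<Rightarrow> bool" where
  "line_poly n H \<longleftrightarrow> (\<forall>A\<in>carrier_mat n n. \<forall>B\<in>carrier_mat n n. \<exists>q. \<forall>t. H (line_mat n A B t) = poly q t)"

lemma line_mat_carrier [simp]: "line_mat n A B t \<in> carrier_mat n n"
  by (simp add: line_mat_def)

lemma line_mat_ends:
  assumes "A \<in> carrier_mat n n" "B \<in> carrier_mat n n"
  shows "line_mat n A B 0 = A" "line_mat n A B 1 = B"
  using assms by (auto simp: line_mat_def)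

lemma line_poly_const: "line_poly n (\<lambda>_. c)"
  unfolding line_poly_def by (auto intro: exI[of _ "[:c:]"])

lemma line_poly_index: "r < n \<Longrightarrow> c < n \<Longrightarrow> line_poly n (\<lambda>A. A $$ (r,c))"
  unfolding line_poly_def
proof (intro ballI)
  fix A B :: "'a mat" assume "r < n" "c < n"
  then show "\<exists>q. \<forall>t. line_mat n A B t $$ (r,c) = poly q t"
    by (intro exI[of _ "[: A $$ (r,c), B $$ (r,c) - A $$ (r,c) :]"]) (simp add: line_mat_def algebra_simps)
qed

lemma line_poly_add: "line_poly n H \<Longrightarrow> line_poly n K \<Longrightarrow> line_poly n (\<lambda>A. H A + K A)"
  unfolding line_poly_def by (metis poly_add)

lemma line_poly_mult: "line_poly n H \<Longrightarrow> line_poly n K \<Longrightarrow> line_poly n (\<lambda>A. H A * K A)"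
  unfolding line_poly_def by (metis poly_mult)

lemma line_poly_sum: "(\<And>x. x \<in> S \<Longrightarrow> line_poly n (H x)) \<Longrightarrow> line_poly n (\<lambda>A. \<Sum>x\<in>S. H x A)"
  by (induction S rule: infinite_finite_induct) (auto intro: line_poly_const line_poly_add)

lemma line_poly_prod: "(\<And>x. x \<in> S \<Longrightarrow> line_poly n (H x)) \<Longrightarrow> line_poly n (\<lambda>A. \<Prod>x\<in>S. H x A)"
  by (induction S rule: infinite_finite_induct) (auto intro: line_poly_const line_poly_mult)

lemma line_poly_cong:
  "(\<And>A. A \<in> carrier_mat n n \<Longrightarrow> H A = K A) \<Longrightarrow> line_poly n K \<Longrightarrow> line_poly n H"
  unfolding line_poly_def by simp

lemma line_poly_det:
  assumes M: "\<And>A. A \<in> carrier_mat n n \<Longrightarrow> M A \<in> carrier_mat k k"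
    and ent: "\<And>r c. r < k \<Longrightarrow> c < k \<Longrightarrow> line_poly n (\<lambda>A. M A $$ (r,c))"
  shows "line_poly n (\<lambda>A. det (M A))"
proof (rule line_poly_cong)
  show "det (M A) = (\<Sum>p | p permutes {0..<k}. signof p * (\<Prod>r=0..<k. M A $$ (r, p r)))"
    if "A \<in> carrier_mat n n" for A by (rule det_def'[OF M[OF that]])
  show "line_poly n (\<lambda>A. \<Sum>p | p permutes {0..<k}. signof p * (\<Prod>r=0..<k. M A $$ (r, p r)))"
    by (intro line_poly_sum line_poly_mult line_poly_const line_poly_prod ent)
      (auto dest: permutes_in_image)
qed

lemma line_poly_adj:
  assumes r: "r < n" and c: "c < n"
  shows "line_poly n (\<lambda>A. adj_mat A $$ (r,c))"
proof (rule line_poly_cong)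
  show "adj_mat A $$ (r,c) = (-1) ^ (c + r) * det (mat_delete A c r)"
    if "A \<in> carrier_mat n n" for A
    using that r c by (simp add: adj_mat_def cofactor_def)
  have "line_poly n (\<lambda>A. det (mat_delete A c r))"
  proof (rule line_poly_det)
    show "mat_delete A c r \<in> carrier_mat (n - 1) (n - 1)" if "A \<in> carrier_mat n n" for A
      using mat_delete_carrier[OF that] by simp
    fix x y assume "x < n - 1" "y < n - 1"
    then show "line_poly n (\<lambda>A. mat_delete A c r $$ (x,y))"
      by (intro line_poly_cong[OF _ line_poly_index[of "if x < c then x else Suc x" _ "if y < r then y else Suc y"]])
        (auto simp: mat_delete_def)
  qed
  then show "line_poly n (\<lambda>A. (-1) ^ (c + r) * det (mat_delete A c r))"
    by (intro line_poly_mult line_poly_const)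
qed

text \<open>Let A suit the old functions and B the new one. On the line through them every
  restricted polynomial is nonzero, at t = 0 or at t = 1, so their product has finitely many roots.
  C plays the part of an irreducible variety, and is once a proper linear subspace.\<close>

lemma common_nonzero:
  fixes C :: "'a::field mat set"
  assumes inf: "infinite (UNIV :: 'a set)"
    and C: "C \<subseteq> carrier_mat n n" "C \<noteq> {}"
    and line: "\<And>A B t. A \<in> C \<Longrightarrow> B \<in> C \<Longrightarrow> line_mat n A B t \<in> C"
    and fin: "finite \<H>" and poly: "\<And>H. H \<in> \<H> \<Longrightarrow> line_poly n H"
    and nz: "\<And>H. H \<in> \<H> \<Longrightarrow> \<exists>A\<in>C. H A \<noteq> 0"
  shows "\<exists>A\<in>C. \<forall>H\<in>\<H>. H A \<noteq> 0"
  using fin poly nz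
proof (induction \<H> rule: finite_induct)
  case empty
  then show ?case using C by auto
next
  case (insert K \<H>)
  then obtain A B where A: "A \<in> C" "\<forall>H\<in>\<H>. H A \<noteq> 0" and B: "B \<in> C" "K B \<noteq> 0"
    by (metis insertCI)
  have AB: "A \<in> carrier_mat n n" "B \<in> carrier_mat n n" using A B C by auto
  have "\<forall>H\<in>insert K \<H>. \<exists>q. \<forall>t. H (line_mat n A B t) = poly q t"
    using insert.prems(1) AB unfolding line_poly_def by blast
  then obtain q where q: "\<And>H t. H \<in> insert K \<H> \<Longrightarrow> H (line_mat n A B t) = poly (q H) t"
    by metis
  have "q H \<noteq> 0" if "H \<in> insert K \<H>" for H
  proof
    assume "q H = 0"
    then have "H A = 0" "H B = 0" using q[OF that, of 0] q[OF that, of 1] by (auto simp: line_mat_ends[OF AB])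
    then show False using that A B by auto
  qed
  then have "(\<Prod>H\<in>insert K \<H>. q H) \<noteq> 0" using insert.hyps by simp
  then have "finite {t. poly (\<Prod>H\<in>insert K \<H>. q H) t = 0}" by (rule poly_roots_finite)
  then obtain t where "poly (\<Prod>H\<in>insert K \<H>. q H) t \<noteq> 0"
    using inf by (metis (mono_tags, lifting) ex_new_if_finite mem_Collect_eq)
  then have "\<forall>H\<in>insert K \<H>. poly (q H) t \<noteq> 0"
    using insert.hyps by (auto simp: poly_prod)
  then show ?case using q line[OF A(1) B(1)] by (intro bexI[of _ "line_mat n A B t"]) auto
qed

lemma line_poly_coeff_left:
  assumes M: "M \<in> carrier_mat n n"
    and f: "\<And>r. r < i \<Longrightarrow> f r < n" and h: "\<And>r. r < i \<Longrightarrow> h r < n"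
  shows "line_poly n (\<lambda>P. coeff (fminor (cmat P * M) i f h) e)"
  by (rule line_poly_cong[OF coeff_fminor_cmat_left[OF _ M f h]])
    (use f in \<open>auto intro!: line_poly_sum line_poly_mult line_poly_prod line_poly_const line_poly_index simp: PiE_iff\<close>)

lemma line_poly_coeff_right:
  assumes M: "M \<in> carrier_mat n n"
    and f: "\<And>r. r < i \<Longrightarrow> f r < n" and h: "\<And>r. r < i \<Longrightarrow> h r < n"
  shows "line_poly n (\<lambda>P. coeff (fminor (M * cmat P) i f h) e)"
  by (rule line_poly_cong[OF coeff_fminor_cmat_right[OF _ M f h]])
    (use h in \<open>auto intro!: line_poly_sum line_poly_mult line_poly_prod line_poly_const line_poly_index simp: PiE_iff\<close>)

text \<open>The adjugate replaces the inverse to keep the expression polynomial in g.\<close>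

lemma line_poly_coeff_adj:
  assumes M: "M \<in> carrier_mat n n"
    and f: "\<And>r. r < i \<Longrightarrow> f r < n" and h: "\<And>r. r < i \<Longrightarrow> h r < n"
  shows "line_poly n (\<lambda>g. coeff (fminor (cmat g * M * cmat (adj_mat g)) i f h) e)"
proof (rule line_poly_cong)
  show "coeff (fminor (cmat g * M * cmat (adj_mat g)) i f h) e =
    (\<Sum>\<kappa>\<in>{0..<i} \<rightarrow>\<^sub>E {0..<n}. (\<Prod>r=0..<i. adj_mat g $$ (\<kappa> r, h r)) * coeff (fminor (cmat g * M) i f \<kappa>) e)"
    if "g \<in> carrier_mat n n" for g
    by (rule coeff_fminor_cmat_right) (use that M f h adj_mat(1)[OF that] in auto)
  show "line_poly n (\<lambda>g. \<Sum>\<kappa>\<in>{0..<i} \<rightarrow>\<^sub>E {0..<n}. (\<Prod>r=0..<i. adj_mat g $$ (\<kappa> r, h r)) * coeff (fminor (cmat g * M) i f \<kappa>) e)"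
    by (intro line_poly_sum line_poly_mult line_poly_prod line_poly_adj line_poly_coeff_left M)
      (use f h in \<open>auto simp: PiE_iff\<close>)
qed

lemma cmat_inverse:
  assumes "P \<in> carrier_mat n n" "Q \<in> carrier_mat n n" "P * Q = 1\<^sub>m n"
  shows "cmat P * cmat Q = 1\<^sub>m n"
  using assms by (simp add: cmat_mult[symmetric, of _ n n _ n] cmat_one)

text \<open>With a zero upper right block in Q, the first i rows of the product see only the first i
  rows of M, so leading blocks multiply.\<close>

lemma det_lead_mult:
  assumes Q: "Q \<in> carrier_mat n n" and M: "M \<in> carrier_mat n n" and i: "i \<le> n"
    and zero: "\<And>r c. r < i \<Longrightarrow> i \<le> c \<Longrightarrow> c < n \<Longrightarrow> Q $$ (r,c) = 0"
  shows "fminor (Q * M) i (\<lambda>r. r) (\<lambda>r. r) = fminor Q i (\<lambda>r. r) (\<lambda>r. r) * fminor M i (\<lambda>r. r) (\<lambda>r. r)"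
proof -
  have "mat i i (\<lambda>(r,c). (Q * M) $$ (r,c)) = mat i i (\<lambda>(r,c). Q $$ (r,c)) * mat i i (\<lambda>(r,c). M $$ (r,c))"
  proof (rule eq_matI)
    fix r c assume "r < dim_row (mat i i (\<lambda>(r,c). Q $$ (r,c)) * mat i i (\<lambda>(r,c). M $$ (r,c)))"
      "c < dim_col (mat i i (\<lambda>(r,c). Q $$ (r,c)) * mat i i (\<lambda>(r,c). M $$ (r,c)))"
    then have rc: "r < i" "c < i" by auto
    have "(\<Sum>k\<in>{0..<n}. Q $$ (r,k) * M $$ (k,c)) = (\<Sum>k\<in>{0..<i}. Q $$ (r,k) * M $$ (k,c))"
      by (rule sum.mono_neutral_right) (use i zero rc in auto)
    then show "mat i i (\<lambda>(r,c). (Q * M) $$ (r,c)) $$ (r,c) =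
      (mat i i (\<lambda>(r,c). Q $$ (r,c)) * mat i i (\<lambda>(r,c). M $$ (r,c))) $$ (r,c)"
      using rc i Q M by (simp add: scalar_prod_def)
  qed auto
  then show ?thesis by (simp add: fminor_def det_mult[of _ i])
qed

lemma fminor_cmat:
  assumes Q: "Q \<in> carrier_mat n n" and i: "i \<le> n"
  shows "fminor (cmat Q) i (\<lambda>r. r) (\<lambda>r. r) = [:fminor Q i (\<lambda>r. r) (\<lambda>r. r):]"
proof -
  have h: "comm_ring_hom (\<lambda>x::'a. [:x:])" by unfold_locales (auto simp: one_pCons)
  have "mat i i (\<lambda>(r,c). cmat Q $$ (r,c)) = map_mat (\<lambda>x. [:x:]) (mat i i (\<lambda>(r,c). Q $$ (r,c)))"
    by (rule eq_matI) (use Q i in auto)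
  then show ?thesis unfolding fminor_def using comm_ring_hom.hom_det[OF h] by metis
qed

lemma phi_eq:
  fixes g :: "'a::field mat"
  assumes g: "g \<in> carrier_mat n n" and g': "g' \<in> carrier_mat n n" and inv: "g * g' = 1\<^sub>m n"
  shows "phi g X = g * X * g'" "det g \<noteq> 0"
proof -
  show d: "det g \<noteq> 0" using det_mult[OF g g'] inv by auto
  let ?h = "inverse (det g) \<cdot>\<^sub>m adj_mat g"
  note h = adj_inverse[OF g d]
  have "?h = ?h * (g * g')" by (simp only: inv right_mult_one_mat[OF h(1)])
  also have "\<dots> = ?h * g * g'" by (rule assoc_mult_mat[symmetric, OF h(1) g g'])
  also have "\<dots> = g'" using h g' by simp
  finally show "phi g X = g * X * g'" by (simp add: phi_def)
qed

text \<open>A nonzero coefficient of an arbitrary minor is moved to the leading principal minor: a generic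
  conjugation first frees the rows, and a second one, by a matrix whose last columns are unit
  vectors, frees the columns without disturbing the leading rows.\<close>

lemma leading_minor_of_conjugate:
  fixes X :: "'a::field mat"
  assumes inf: "infinite (UNIV :: 'a set)"
    and X: "X \<in> carrier_mat n n" and i: "i \<le> n"
    and f: "\<And>r. r < i \<Longrightarrow> f r < n" and h: "\<And>r. r < i \<Longrightarrow> h r < n"
    and nz: "coeff (fminor (pmat X) i f h) e \<noteq> 0"
  shows "\<exists>g\<in>carrier_mat n n. det g \<noteq> 0 \<and> coeff (fminor (pmat (phi g X)) i (\<lambda>r. r) (\<lambda>r. r)) e \<noteq> 0"
proof -
  let ?id = "\<lambda>r::nat. r"
  have idn: "?id r < n" if "r < i" for r using that i by simp
  have line_det: "line_poly n (\<lambda>A::'a mat. det A)"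
    by (rule line_poly_det) (auto intro: line_poly_index)
  \<comment> \<open>Copies row \<open>f r\<close> into row r for r < i. It may be singular: it only
    shows that the coefficient does not vanish for all P, and genericity then supplies an invertible
    P.\<close>
  define Pf :: "'a mat" where "Pf = mat n n (\<lambda>(r,c). if c = f r then 1 else 0)"
  have Pf: "Pf \<in> carrier_mat n n" by (simp add: Pf_def)
  have pX: "pmat X \<in> carrier_mat n n" using X by simp
  have Pf_minor: "fminor (cmat Pf * pmat X) i ?id h = fminor (pmat X) i f h"
    unfolding fminor_def
  proof (intro arg_cong[of _ _ det] eq_matI)
    fix r c assume "r < dim_row (mat i i (\<lambda>(r,c). pmat X $$ (f r, h c)))"
      "c < dim_col (mat i i (\<lambda>(r,c). pmat X $$ (f r, h c)))"
    then have rc: "r < i" "c < i" by auto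
    have "(cmat Pf * pmat X) $$ (r, h c) = (\<Sum>k\<in>{0..<n}. (if k = f r then pmat X $$ (k, h c) else 0))"
      using rc i h pX Pf
      by (auto simp: scalar_prod_def Pf_def if_distrib[of "\<lambda>x. Polynomial.smult x _"] cong: if_cong)
    also have "\<dots> = pmat X $$ (f r, h c)" using f rc by simp
    finally show "mat i i (\<lambda>(r,c). (cmat Pf * pmat X) $$ (r, h c)) $$ (r,c) =
      mat i i (\<lambda>(r,c). pmat X $$ (f r, h c)) $$ (r,c)" using rc by simp
  qed auto
  let ?H1 = "\<lambda>P. coeff (fminor (cmat P * pmat X) i ?id h) e"
  have "\<exists>P\<in>carrier_mat n n. \<forall>H\<in>{\<lambda>A. det A, ?H1}. H P \<noteq> 0"
  proof (rule common_nonzero[OF inf])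
    show "line_poly n H" if "H \<in> {\<lambda>A. det A, ?H1}" for H
      using that line_det line_poly_coeff_left[OF pX idn h] by auto
    show "\<exists>A\<in>carrier_mat n n. H A \<noteq> 0" if "H \<in> {\<lambda>A. det A, ?H1}" for H
    proof -
      from that consider "H = (\<lambda>A. det A)" | "H = ?H1" by blast
      then show ?thesis
      proof cases
        case 1
        then show ?thesis by (intro bexI[of _ "1\<^sub>m n"]) auto
      next
        case 2
        then show ?thesis using Pf nz by (intro bexI[of _ Pf]) (simp_all only: Pf_minor, simp_all)
      qed
    qed
  qed auto
  then obtain P where P: "P \<in> carrier_mat n n" "det P \<noteq> 0" "?H1 P \<noteq> 0" by auto
  define P' where "P' = inverse (det P) \<cdot>\<^sub>m adj_mat P"
  have P': "P' \<in> carrier_mat n n" "P * P' = 1\<^sub>m n" "P' * P = 1\<^sub>m n"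
    unfolding P'_def using adj_inverse[OF P(1,2)] by auto
  define X1 where "X1 = P * X * P'"
  have X1: "X1 \<in> carrier_mat n n" unfolding X1_def using P X P' by simp
  have pX1: "pmat X1 \<in> carrier_mat n n" using X1 by simp
  have c: "cmat P \<in> carrier_mat n n" "cmat P' \<in> carrier_mat n n" using P P' by auto
  have "pmat X1 * cmat P = cmat P * pmat X * (cmat P' * cmat P)"
    unfolding X1_def pmat_conj[OF P(1) P'(1,2) X]
    by (rule assoc_mult_mat) (use c pX in auto)
  also have "\<dots> = cmat P * pmat X"
    using cmat_inverse[OF P'(1) P(1) P'(3)] c pX by simp
  finally have e1: "cmat P * pmat X = pmat X1 * cmat P" by simp
  \<comment> \<open>Expanded as \<open>pmat X1 * cmat P\<close>, the nonzero coefficient combines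
    those of minors of X1 with leading rows; so one of these is nonzero for some choice of
    columns.\<close>
  have "\<exists>\<kappa>\<in>{0..<i} \<rightarrow>\<^sub>E {0..<n}. coeff (fminor (pmat X1) i ?id \<kappa>) e \<noteq> 0"
  proof (rule ccontr)
    assume "\<not> ?thesis"
    then have "coeff (fminor (pmat X1 * cmat P) i ?id h) e = 0"
      using coeff_fminor_cmat_right[where f = ?id and h = h and i = i and e = e, OF P(1) pX1 idn h] by (simp add: sum.neutral)
    then show False using P(3) e1 by simp
  qed
  then obtain \<kappa> where \<kappa>_mem: "\<kappa> \<in> {0..<i} \<rightarrow>\<^sub>E {0..<n}"
    and \<kappa>_nz: "coeff (fminor (pmat X1) i ?id \<kappa>) e \<noteq> 0" by blast
  have \<kappa>: "\<kappa> r < n" if "r < i" for r using \<kappa>_mem that by (auto simp: PiE_iff)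
  \<comment> \<open>Matrices with zero upper right block: a linear space, so lines stay inside, and
    as left factors they only rescale the leading i-minor.\<close>
  define C where "C = {Q \<in> carrier_mat n n. \<forall>r c. r < i \<longrightarrow> i \<le> c \<longrightarrow> c < n \<longrightarrow> Q $$ (r,c) = (0::'a)}"
  \<comment> \<open>Copies column \<open>\<kappa> c\<close> into column c for c < i; like
    \<open>Pf\<close> it is only a witness of non-vanishing and may be singular.\<close>
  define Qh :: "'a mat" where "Qh = mat n n (\<lambda>(r,c). if c < i then (if r = \<kappa> c then 1 else 0) else if r = c then 1 else 0)"
  have Qh: "Qh \<in> C" using i by (auto simp: C_def Qh_def)
  have one: "1\<^sub>m n \<in> C" using i by (auto simp: C_def)
  have Qh_minor: "fminor (pmat X1 * cmat Qh) i ?id ?id = fminor (pmat X1) i ?id \<kappa>"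
    unfolding fminor_def
  proof (intro arg_cong[of _ _ det] eq_matI)
    fix r c assume "r < dim_row (mat i i (\<lambda>(r,c). pmat X1 $$ (r, \<kappa> c)))"
      "c < dim_col (mat i i (\<lambda>(r,c). pmat X1 $$ (r, \<kappa> c)))"
    then have rc: "r < i" "c < i" by auto
    have "(pmat X1 * cmat Qh) $$ (r, c) = (\<Sum>k\<in>{0..<n}. (if k = \<kappa> c then pmat X1 $$ (r, k) else 0))"
      using rc i pX1
      by (auto simp: scalar_prod_def Qh_def if_distrib[of "\<lambda>x. Polynomial.smult x _"] cong: if_cong)
    also have "\<dots> = pmat X1 $$ (r, \<kappa> c)" using \<kappa> rc by simp
    finally show "mat i i (\<lambda>(r,c). (pmat X1 * cmat Qh) $$ (r, c)) $$ (r,c) =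
      mat i i (\<lambda>(r,c). pmat X1 $$ (r, \<kappa> c)) $$ (r,c)" using rc by simp
  qed auto
  let ?H2 = "\<lambda>Q. coeff (fminor (pmat X1 * cmat Q) i ?id ?id) e"
  have "\<exists>Q\<in>C. \<forall>H\<in>{\<lambda>A. det A, ?H2}. H Q \<noteq> 0"
  proof (rule common_nonzero[OF inf])
    show "line_mat n A B t \<in> C" if "A \<in> C" "B \<in> C" for A B t
      using that i by (auto simp: C_def line_mat_def)
    show "line_poly n H" if "H \<in> {\<lambda>A. det A, ?H2}" for H
      using that line_det line_poly_coeff_right[OF pX1 idn idn] by auto
    show "\<exists>A\<in>C. H A \<noteq> 0" if "H \<in> {\<lambda>A. det A, ?H2}" for H
    proof -
      from that consider "H = (\<lambda>A. det A)" | "H = ?H2" by blast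
      then show ?thesis
      proof cases
        case 1
        then show ?thesis using one by (intro bexI[of _ "1\<^sub>m n"]) auto
      next
        case 2
        then show ?thesis using Qh \<kappa>_nz by (intro bexI[of _ Qh]) (simp_all only: Qh_minor, simp_all)
      qed
    qed
    show "C \<subseteq> carrier_mat n n" by (auto simp: C_def)
    show "C \<noteq> {}" using one by blast
  qed auto
  then obtain Q where Q: "Q \<in> C" "det Q \<noteq> 0" "?H2 Q \<noteq> 0" by auto
  have QC: "Q \<in> carrier_mat n n" using Q by (simp add: C_def)
  define Q' where "Q' = inverse (det Q) \<cdot>\<^sub>m adj_mat Q"
  have Q': "Q' \<in> carrier_mat n n" "Q * Q' = 1\<^sub>m n" "Q' * Q = 1\<^sub>m n"
    unfolding Q'_def using adj_inverse[OF QC Q(2)] by auto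
  \<comment> \<open>This order of Q' and Q turns the right factor of \<open>pmat X1 * cmat Q\<close>
    into the left factor of \<open>cmat Q * pmat X2\<close>, where the zero block of Q
    applies.\<close>
  define X2 where "X2 = Q' * X1 * Q"
  have X2: "X2 \<in> carrier_mat n n" unfolding X2_def using QC X1 Q' by simp
  have pX2: "pmat X2 \<in> carrier_mat n n" using X2 by simp
  have d: "cmat Q \<in> carrier_mat n n" "cmat Q' \<in> carrier_mat n n" using QC Q' by auto
  have "cmat Q * pmat X2 = cmat Q * (cmat Q' * (pmat X1 * cmat Q))"
    unfolding X2_def pmat_conj[OF Q'(1) QC Q'(3) X1]
    by (intro arg_cong[of _ _ "(*) (cmat Q)"] assoc_mult_mat) (use d pX1 in auto)
  also have "\<dots> = cmat Q * cmat Q' * (pmat X1 * cmat Q)"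
    by (rule assoc_mult_mat[symmetric]) (use d pX1 in auto)
  also have "\<dots> = pmat X1 * cmat Q"
    using cmat_inverse[OF QC Q'(1,2)] d pX1 by (simp add: left_mult_one_mat[of _ n n])
  finally have "fminor (pmat X1 * cmat Q) i ?id ?id = fminor (cmat Q * pmat X2) i ?id ?id" by simp
  also have "\<dots> = fminor (cmat Q) i ?id ?id * fminor (pmat X2) i ?id ?id"
    by (rule det_lead_mult[OF d(1) pX2 i]) (use Q(1) i in \<open>auto simp: C_def\<close>)
  also have "\<dots> = Polynomial.smult (fminor Q i ?id ?id) (fminor (pmat X2) i ?id ?id)"
    unfolding fminor_cmat[OF QC i] by simp
  finally have nz2: "coeff (fminor (pmat X2) i ?id ?id) e \<noteq> 0" using Q(3) by auto
  have g: "Q' * P \<in> carrier_mat n n" "P' * Q \<in> carrier_mat n n" using P P' QC Q' by auto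
  have "P * (P' * Q) = P * P' * Q"
    by (rule assoc_mult_mat[symmetric]) (use P P' QC in auto)
  also have "\<dots> = Q" using P'(2) QC by simp
  finally have "Q' * P * (P' * Q) = Q' * Q"
    using assoc_mult_mat[OF Q'(1) P(1) g(2)] by simp
  then have inv: "Q' * P * (P' * Q) = 1\<^sub>m n" using Q' by simp
  have "phi (Q' * P) X = X2"
    unfolding phi_eq(1)[OF g inv] X2_def X1_def
    using P P' QC Q' X by (simp add: assoc_mult_mat[of _ n n _ n _ n])
  then show ?thesis using nz2 g(1) phi_eq(2)[OF g inv] by (intro bexI[of _ "Q' * P"]) auto
qed

text \<open>Each of the i columns carries one factor det g.\<close>

lemma coeff_adj_minor:
  fixes X :: "'a::field mat"
  assumes g: "g \<in> carrier_mat n n" and d: "det g \<noteq> 0" and X: "X \<in> carrier_mat n n"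
    and f: "\<And>r. r < i \<Longrightarrow> f r < n" and h: "\<And>r. r < i \<Longrightarrow> h r < n"
  shows "coeff (fminor (cmat g * pmat X * cmat (adj_mat g)) i f h) e =
    det g ^ i * coeff (fminor (pmat (phi g X)) i f h) e"
proof -
  let ?g' = "inverse (det g) \<cdot>\<^sub>m adj_mat g"
  note g' = adj_inverse[OF g d]
  have a: "adj_mat g \<in> carrier_mat n n" using adj_mat(1)[OF g] .
  have M: "cmat g * pmat X \<in> carrier_mat n n" using g X by simp
  have entry: "(\<Prod>r=0..<i. adj_mat g $$ (\<kappa> r, h r)) = det g ^ i * (\<Prod>r=0..<i. ?g' $$ (\<kappa> r, h r))"
    if "\<kappa> \<in> {0..<i} \<rightarrow>\<^sub>E {0..<n}" for \<kappa>
  proof -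
    have "(\<Prod>r=0..<i. adj_mat g $$ (\<kappa> r, h r)) = (\<Prod>r=0..<i. det g * ?g' $$ (\<kappa> r, h r))"
      using that h a d by (intro prod.cong) (auto simp: PiE_iff)
    then show ?thesis by (simp add: prod.distrib)
  qed
  have "phi g X = g * X * ?g'" by (simp add: phi_def)
  then have "pmat (phi g X) = cmat g * pmat X * cmat ?g'"
    using pmat_conj[OF g g'(1,2) X] by simp
  then show ?thesis
    using coeff_fminor_cmat_right[OF g'(1) M f h] coeff_fminor_cmat_right[OF a M f h] entry
    by (simp add: sum_distrib_left mult.assoc)
qed

lemma f_lam_nonzero:
  assumes inf: "infinite (UNIV :: 'a::field set)" and n: "n = sum_list nu"
  shows "\<exists>g\<in>carrier_mat n n. \<exists>X\<in>u_P nu. invertible_mat g \<and> f_lam nu (phi g X) \<noteq> (0::'a)"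
proof -
  let ?id = "\<lambda>r::nat. r"
  define X :: "'a mat" where "X = chain_mat n (offset nu)"
  have Xu: "X \<in> u_P nu" unfolding X_def n by (rule chain_mat_in_u_P)
  have XC: "X \<in> carrier_mat n n" by (simp add: X_def)
  have pX: "pmat X \<in> carrier_mat n n" using XC by simp
  \<comment> \<open>A polynomial condition on g for each i, with the same X; for invertible g it
    differs from the i-th factor of \<open>f_lam\<close> by a power of det g. One g then meets all
    of them together with det g nonzero.\<close>
  define H where "H i g = coeff (fminor (cmat g * pmat X * cmat (adj_mat g)) i ?id ?id) (d_lam nu i)" for i g
  have wit: "\<exists>g\<in>carrier_mat n n. H i g \<noteq> 0" if i: "i < n" for i
  proof -
    have ni: "n - (n - i) = i" using i by simp
    obtain f h where fh: "\<And>r. r < i \<Longrightarrow> f r < n" "\<And>r. r < i \<Longrightarrow> h r < n"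
      "fminor (pmat X) i f h = monom 1 ((\<Sum>v\<leftarrow>nu. min (n - i) v) - (n - i))"
      using extremal_minor_u_P[OF n diff_le_self, of i, where 'a = 'a] unfolding ni X_def by blast
    have "coeff (fminor (pmat X) i f h) (d_lam nu i) \<noteq> 0"
      unfolding fh(3) using i n by (simp add: d_lam_eq)
    from leading_minor_of_conjugate[OF inf XC less_imp_le[OF i] fh(1,2) this]
    obtain g where "g \<in> carrier_mat n n" "det g \<noteq> 0"
      "coeff (fminor (pmat (phi g X)) i ?id ?id) (d_lam nu i) \<noteq> 0" by blast
    then show ?thesis unfolding H_def using i
      by (intro bexI[of _ g]) (auto simp: coeff_adj_minor[OF _ _ XC])
  qed
  have "\<exists>g\<in>carrier_mat n n. \<forall>K\<in>insert (\<lambda>g. det g) (H ` {1..<n}). K g \<noteq> 0"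
  proof (rule common_nonzero[OF inf])
    show "line_poly n K" if "K \<in> insert (\<lambda>g. det g) (H ` {1..<n})" for K
      using that line_poly_coeff_adj[OF pX] unfolding H_def
      by (auto intro: line_poly_det line_poly_index)
    show "\<exists>A\<in>carrier_mat n n. K A \<noteq> 0" if K: "K \<in> insert (\<lambda>g. det g) (H ` {1..<n})" for K
    proof (cases "K = (\<lambda>g. det g)")
      case True
      then show ?thesis by (intro bexI[of _ "1\<^sub>m n"]) auto
    next
      case False
      then show ?thesis using K wit by auto
    qed
  qed auto
  then obtain g where g: "g \<in> carrier_mat n n" "det g \<noteq> 0" "\<And>i. i \<in> {1..<n} \<Longrightarrow> H i g \<noteq> 0" by auto
  have Y: "phi g X \<in> carrier_mat n n" by (rule phi_carrier[OF g(1) XC])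
  have "coeff (det (pmat (lead_sub (phi g X) i))) (d_lam nu i) \<noteq> 0" if "i \<in> {1..<n}" for i
    using g(3)[OF that] that unfolding H_def
    by (simp add: coeff_adj_minor[OF g(1,2) XC] det_lead_pmat[OF Y])
  then have "f_lam nu (phi g X) \<noteq> 0" using f_lam_eq[of "phi g X" nu] Y n by auto
  then show ?thesis using g(1) Xu det_nonzero_invertible[OF g(1,2)] by blast
qed

text \<open>Points of the bundle are represented by pairs \<open>(g, X)\<close> with g invertible.
  As \<open>phi g X\<close> always lies in the orbit closure, the exceptional locus consists of the
  pairs with \<open>phi g X\<close> outside the orbit.\<close>

theorem theorem2p4:
  fixes nu :: "nat list" and n p :: nat
    and sigma :: "'a::field mat \<Rightarrow> 'a mat \<Rightarrow> 'a"
  assumes "alg_closed_field TYPE('a)"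
    and "CHAR('a) = p" and "p > 0"
    and "composition nu n"
    and "sigma = (\<lambda>g X. (F_KLT n (phi g X)) ^ (p - 1))"
  shows "(\<forall>d > (p - 1) * dim_G_mod_P nu. \<forall>g \<in> carrier_mat n n. \<forall>X \<in> u_P nu.
            invertible_mat g \<longrightarrow> hom_comp sigma d g X = 0)
     \<and> (\<exists>g \<in> carrier_mat n n. \<exists>X \<in> u_P nu.
            invertible_mat g \<and> hom_comp sigma ((p - 1) * dim_G_mod_P nu) g X \<noteq> 0)
     \<and> (\<forall>g \<in> carrier_mat n n. \<forall>X \<in> u_P nu. invertible_mat g \<longrightarrow>
            hom_comp sigma ((p - 1) * dim_G_mod_P nu) g X = (f_lam nu (phi g X)) ^ (p - 1))
     \<and> (\<forall>g \<in> carrier_mat n n. \<forall>X \<in> u_P nu. invertible_mat g \<longrightarrow>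
            phi g X \<notin> (nil_orbit (lam_list nu) :: 'a mat set) \<longrightarrow> f_lam nu (phi g X) = 0)"
proof -
  have inf: "infinite (UNIV :: 'a set)" by (rule alg_closed_infinite[OF assms(1)])
  have n: "n = sum_list nu" using assms(4) by (simp add: composition_def)
  note comp = hom_comp_sigma[OF inf n, of _ _ "p - 1", folded assms(5)]
  have orbit: "phi g X \<in> nil_orbit (lam_list nu)"
    if "g \<in> carrier_mat n n" "X \<in> u_P nu" "invertible_mat g" "f_lam nu (phi g X) \<noteq> 0" for g X :: "'a mat"
  proof (rule nil_orbit_of_f_lam_nonzero[OF that(2) _ that(4)])
    show "similar_mat (phi g X) X"
      using that invertible_det_nonzero[OF that(1,3)] n
      by (intro phi_similar[of _ n]) (auto simp: u_P_def)
  qed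
  obtain g X where "g \<in> carrier_mat n n" "X \<in> u_P nu" "invertible_mat g" "f_lam nu (phi g X) \<noteq> (0::'a)"
    using f_lam_nonzero[OF inf n] by blast
  then have "\<exists>g \<in> carrier_mat n n. \<exists>X \<in> u_P nu.
      invertible_mat g \<and> hom_comp sigma ((p - 1) * dim_G_mod_P nu) g X \<noteq> 0"
    using comp(2) by (intro bexI[of _ g] bexI[of _ X]) auto
  then show ?thesis using comp orbit by blast
qed

end
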